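(* Let $Q,R,\widehat Q,\widehat R$ be the factors of the thin QR decompositions $$QR = M^{-1/2}F^T\Gamma^{-1/2}\in\mathbb R^{n\times m},\qquad \widehat Q\widehat R = M^{-1/2}CM^{-1}\left[Q^T\ast Q\right]^T\in\mathbb R^{n\times \ell^2},$$ with $Q\in\mathbb R^{n\times\ell}$, $R\in\mathbb R^{\ell\times m}$, $Q^TQ=I_\ell$, $\widehat Q\in\mathbb R^{n\times\hat\ell}$, $\widehat R\in\mathbb R^{\hat\ell\times\ell^2}$, $\widehat Q^T\widehat Q=I_{\hat\ell}$. Define $$\widehat C:=\widehat Q^TM^{-1/2}CM^{-1}CM^{-1/2}\widehat Q\in\mathbb R^{\hat\ell\times\hat\ell},\quad L_{\mathbf w}:=R\,\mathrm{Diag}(\mathbf w)R^T\in\mathbb R^{\ell\times\ell},\quad \widehat L_{\mathbf w}:=\widehat R[L_{\mathbf w}\otimes L_{\mathbf w}]\widehat R^T\in\mathbb R^{\hat\ell\times\hat\ell},$$ let $\widehat C=\widehat D^T\widehat D$ be a Cholesky decomposition with $\widehat D\in\mathbb R^{\hat\ell\times\hat\ell}$, and for $1\le i\le\hat\ell$ let $$\widetilde L_{\mathbf w}(i):=\mathrm{mat}\Big(\big[\widehat R^T(\widehat L_{\mathbf w}+I_{\hat\ell})^{-1}\widehat D^T\big]_{:i}\Big)\in\mathbb R^{\ell\times\ell},$$ where $[\cdot]_{:i}$ denotes the $i$-th column. Then, in a neighborhood of $[0,1]^m$ in $\mathbb R^m$, the A-optimal objective $\mathcal J(\mathbf w)=\mathrm{tr}(\mathcal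 C_{\mathrm{post}}(\mathbf w))$ and its gradient satisfy $$\mathcal J(\mathbf w)=\mathrm{tr}(M^{-1}CM^{-1}C)-\mathrm{tr}(\widehat C)+\mathrm{tr}\Big(\big(\widehat L_{\mathbf w}+I_{\hat\ell}\big)^{-1}\widehat C\Big),$$ $$\nabla\mathcal J(\mathbf w)=-\mathrm{SumCol}\bigg(R\odot\Big[\Big(\sum_{i=1}^{\hat\ell}\widetilde L_{\mathbf w}(i)L_{\mathbf w}\widetilde L_{\mathbf w}(i)^T+\widetilde L_{\mathbf w}(i)^TL_{\mathbf w}\widetilde L_{\mathbf w}(i)\Big)R\Big]\bigg),$$ where $\mathrm{SumCol}$ maps a matrix to the vector containing the sum of the entries of each of its columns. Moreover, $\mathcal J$ is monotone decreasing in $\mathbf w$: for $\mathbf w,\mathbf w'\in[0,1]^m$ with $\mathbf w\le\mathbf w'$ componentwise, $\mathcal J(\mathbf w)\ge\mathcal J(\mathbf w')$.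
   Context: Discretization. $\Omega\subset\mathbb R^d$ is partitioned (triangulated) into elements $\Omega_1,\dots,\Omega_n$ of positive measure; $V_h^0\subset L^2(\Omega)$ is the span of the indicator functions $\varphi_i=\mathbf 1_{\Omega_i}$, with the $L^2$ inner product. A function $g_h=\sum_i g_i\varphi_i$ has coefficient vector $(g_1,\dots,g_n)^T$. $M=\mathrm{Diag}(m_1,\dots,m_n)$, $m_i=|\Omega_i|$, is the mass matrix. A linear operator $\mathcal A:V_h^0\to V_h^0$ has matrix representation $M^{-1}A$, where $A_{ij}=(\mathcal A\varphi_j,\varphi_i)_{L^2}$; this means that $\mathcal A g_h$ has coefficient vector $M^{-1}A\boldsymbol g$ whenever $g_h$ has coefficient vector $\boldsymbol g$. For such $\mathcal A$ (with kernel $k=\sum_{i,j} m_i^{-1}A_{ij}m_j^{-1}\varphi_i(x)\varphi_j(y)$, so $\mathcal A f(x)=\int_\Omega k(x,y)f(y)\,dy$), $\mathrm{diag}(\mathcal A)\in V_h^0$ is the function $x\mapsto k(x,x)$. For $q_h\in V_h^0$, $\mathrm{Diag}(q_h):V_h^0\to V_h^0$ is multiplication by $q_h$; for a vector $\mathbf w$, $\mathrm{Diag}(\mathbf w)$ is the diagonal matrix with diagonal $\mathbf w$. Model. $\mathcal F:V_h^0\to\mathbb R^m$ is linear with matrix $F\in\mathbb R^{m\times n}$, $F_{ij}=(\mathcal F\varphi_j)_i$; its $L^2$-adjoint $\mathcal F^*:\mathbb R^m\to V_h^0$ has matrix $M^{-1}F^T$. $\Gamma\in\mathbb R^{m\times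 m}$ is a diagonal positive definite noise covariance. The prior covariance $\mathcal C_0:V_h^0\to V_h^0$ is self-adjoint positive definite, and $\mathcal C_0^{1/2}$ has matrix representation $M^{-1}C$ (so $C$ is symmetric and invertible). With $\Gamma_{\mathbf w}^\dagger=\Gamma^{-1/2}\mathrm{Diag}(\mathbf w)\Gamma^{-1/2}$, the posterior covariance is $$\mathcal C_{\mathrm{post}}(\mathbf w)=\big(\mathcal H_{\mathbf w}+\mathcal C_0^{-1}\big)^{-1},\qquad \mathcal H_{\mathbf w}q=\mathrm{diag}\big(\mathcal F^*\Gamma_{\mathbf w}^\dagger\mathcal F\,\mathrm{Diag}(q)\,\mathcal F^*\Gamma_{\mathbf w}^\dagger\mathcal F\big).$$ Matrix products. $\mathrm{vec}$ stacks the columns of a matrix, $\mathrm{mat}$ is its inverse on vectors of square length (producing square matrices). The Kronecker product convention is $(A\otimes B)\mathbf x=\mathrm{vec}(A\,\mathrm{mat}(\mathbf x)B^T)$. $\odot$ is the entrywise product of matrices of equal size. $Q^T\ast Q\in\mathbb R^{\ell^2\times n}$ is the column-wise Khatri–Rao product with entries $(Q^T\ast Q)_{i+(k-1)\ell,\,j}=Q_{jk}Q_{ji}$ for $1\le i,k\le\ell$, $1\le j\le n$. *)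

theory Defs
  imports "HOL-Analysis.Analysis"
begin

section \<open>The space of piecewise constant functions\<close>

text \<open>Elements of \<open>L\<^sup>2(\<Omega>)\<close> are functions on the ambient space, extended by zero outside \<open>\<Omega>\<close>.
  As the elements are disjoint and of positive measure, two functions in \<open>Vh E\<close> that agree
  almost everywhere are equal, so no quotient by null sets is needed.\<close>

definition is_mesh :: "(real^'d) set \<Rightarrow> ('n::finite \<Rightarrow> (real^'d) set) \<Rightarrow> bool" where
  "is_mesh \<Omega> E \<longleftrightarrow> \<Omega> = (\<Union>i. E i) \<and> disjoint_family E \<and>
     (\<forall>i. E i \<in> lmeasurable \<and> 0 < measure lebesgue (E i))"

definition Vh :: "('n::finite \<Rightarrow> (real^'d) set) \<Rightarrow> (real^'d \<Rightarrow> real) set" where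
  "Vh E = {f. \<exists>g::real^'n. f = (\<lambda>x. \<Sum>i\<in>UNIV. g $ i * indicator (E i) x)}"

definition l2_inner :: "(real^'d) set \<Rightarrow> (real^'d \<Rightarrow> real) \<Rightarrow> (real^'d \<Rightarrow> real) \<Rightarrow> real" where
  "l2_inner \<Omega> f g = (LINT x:\<Omega>|lebesgue. f x * g x)"

section \<open>Operators on the space and their matrices\<close>

text \<open>Operators on \<open>Vh E\<close> are maps on all functions of which only the values on \<open>Vh E\<close> matter.\<close>

definition lin_op :: "(real^'d \<Rightarrow> real) set \<Rightarrow> ((real^'d \<Rightarrow> real) \<Rightarrow> (real^'d \<Rightarrow> real)) \<Rightarrow> bool" where
  "lin_op V A \<longleftrightarrow> (\<forall>f\<in>V. A f \<in> V) \<and>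
     (\<forall>f\<in>V. \<forall>g\<in>V. \<forall>a b. A (\<lambda>x. a * f x + b * g x) = (\<lambda>x. a * A f x + b * A g x))"

definition lin_obs :: "(real^'d \<Rightarrow> real) set \<Rightarrow> ((real^'d \<Rightarrow> real) \<Rightarrow> real^'m) \<Rightarrow> bool" where
  "lin_obs V F \<longleftrightarrow>
     (\<forall>f\<in>V. \<forall>g\<in>V. \<forall>a b. F (\<lambda>x. a * f x + b * g x) = a *\<^sub>R F f + b *\<^sub>R F g)"

definition self_adjoint_op ::
  "(real^'d) set \<Rightarrow> (real^'d \<Rightarrow> real) set \<Rightarrow> ((real^'d \<Rightarrow> real) \<Rightarrow> (real^'d \<Rightarrow> real)) \<Rightarrow> bool" where
  "self_adjoint_op \<Omega> V A \<longleftrightarrow> (\<forall>f\<in>V. \<forall>g\<in>V. l2_inner \<Omega> (A f) g = l2_inner \<Omega> f (A g))"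

definition pos_def_op ::
  "(real^'d) set \<Rightarrow> (real^'d \<Rightarrow> real) set \<Rightarrow> ((real^'d \<Rightarrow> real) \<Rightarrow> (real^'d \<Rightarrow> real)) \<Rightarrow> bool" where
  "pos_def_op \<Omega> V A \<longleftrightarrow> (\<forall>f\<in>V. f \<noteq> (\<lambda>_. 0) \<longrightarrow> 0 < l2_inner \<Omega> (A f) f)"

text \<open>\<open>S\<close> is the positive square root of \<open>A\<close>; on \<open>V\<close> it is uniquely determined.\<close>

definition is_op_sqrt ::
  "(real^'d) set \<Rightarrow> (real^'d \<Rightarrow> real) set \<Rightarrow> ((real^'d \<Rightarrow> real) \<Rightarrow> (real^'d \<Rightarrow> real)) \<Rightarrow>
   ((real^'d \<Rightarrow> real) \<Rightarrow> (real^'d \<Rightarrow> real)) \<Rightarrow> bool" where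
  "is_op_sqrt \<Omega> V A S \<longleftrightarrow> lin_op V S \<and> self_adjoint_op \<Omega> V S \<and>
     (\<forall>f\<in>V. 0 \<le> l2_inner \<Omega> (S f) f) \<and> (\<forall>f\<in>V. S (S f) = A f)"

definition Diag :: "real^'n \<Rightarrow> real^'n^'n" where
  "Diag v = (\<chi> i j. if i = j then v $ i else 0)"

text \<open>The inverse square root of a diagonal matrix with positive diagonal.\<close>

definition inv_sqrt_diag :: "real^'n^'n \<Rightarrow> real^'n^'n" where
  "inv_sqrt_diag D = Diag (\<chi> i. 1 / sqrt (D $ i $ i))"

definition mass_mat :: "('n::finite \<Rightarrow> (real^'d) set) \<Rightarrow> real^'n^'n" where
  "mass_mat E = Diag (\<chi> i. measure lebesgue (E i))"

text \<open>\<open>op_mat \<Omega> E A\<close> is the matrix \<open>A\<^sub>i\<^sub>j = (A \<phi>\<^sub>j, \<phi>\<^sub>i)\<close>; the matrix that acts on coefficient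
  vectors is its product with the inverse of the mass matrix.\<close>

definition op_mat ::
  "(real^'d) set \<Rightarrow> ('n::finite \<Rightarrow> (real^'d) set) \<Rightarrow> ((real^'d \<Rightarrow> real) \<Rightarrow> (real^'d \<Rightarrow> real)) \<Rightarrow>
   real^'n^'n" where
  "op_mat \<Omega> E A = (\<chi> i j. l2_inner \<Omega> (A (indicator (E j))) (indicator (E i)))"

definition op_trace ::
  "(real^'d) set \<Rightarrow> ('n::finite \<Rightarrow> (real^'d) set) \<Rightarrow> ((real^'d \<Rightarrow> real) \<Rightarrow> (real^'d \<Rightarrow> real)) \<Rightarrow>
   real" where
  "op_trace \<Omega> E A = trace (matrix_inv (mass_mat E) ** op_mat \<Omega> E A)"

definition op_kernel ::
  "(real^'d) set \<Rightarrow> ('n::finite \<Rightarrow> (real^'d) set) \<Rightarrow> ((real^'d \<Rightarrow> real) \<Rightarrow> (real^'d \<Rightarrow> real)) \<Rightarrow>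
   real^'d \<Rightarrow> real^'d \<Rightarrow> real" where
  "op_kernel \<Omega> E A x y = (\<Sum>i\<in>UNIV. \<Sum>j\<in>UNIV.
     inverse (measure lebesgue (E i)) * op_mat \<Omega> E A $ i $ j * inverse (measure lebesgue (E j))
       * indicator (E i) x * indicator (E j) y)"

definition op_diag ::
  "(real^'d) set \<Rightarrow> ('n::finite \<Rightarrow> (real^'d) set) \<Rightarrow> ((real^'d \<Rightarrow> real) \<Rightarrow> (real^'d \<Rightarrow> real)) \<Rightarrow>
   (real^'d \<Rightarrow> real)" where
  "op_diag \<Omega> E A = (\<lambda>x. op_kernel \<Omega> E A x x)"

definition mult_op :: "(real^'d \<Rightarrow> real) \<Rightarrow> (real^'d \<Rightarrow> real) \<Rightarrow> (real^'d \<Rightarrow> real)" where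
  "mult_op q f = (\<lambda>x. q x * f x)"

section \<open>The posterior covariance and the A-optimal objective\<close>

definition obs_mat ::
  "('n::finite \<Rightarrow> (real^'d) set) \<Rightarrow> ((real^'d \<Rightarrow> real) \<Rightarrow> real^'m) \<Rightarrow> real^'n^'m" where
  "obs_mat E F = (\<chi> i j. F (indicator (E j)) $ i)"

definition obs_adjoint ::
  "(real^'d) set \<Rightarrow> (real^'d \<Rightarrow> real) set \<Rightarrow> ((real^'d \<Rightarrow> real) \<Rightarrow> real^'m) \<Rightarrow>
   real^'m \<Rightarrow> (real^'d \<Rightarrow> real)" where
  "obs_adjoint \<Omega> V F y = (THE g. g \<in> V \<and> (\<forall>f\<in>V. l2_inner \<Omega> g f = y \<bullet> F f))"

definition Gamma_dag :: "real^'m^'m \<Rightarrow> real^'m \<Rightarrow> real^'m^'m" where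
  "Gamma_dag \<Gamma> w = inv_sqrt_diag \<Gamma> ** Diag w ** inv_sqrt_diag \<Gamma>"

definition misfit_op ::
  "(real^'d) set \<Rightarrow> ('n::finite \<Rightarrow> (real^'d) set) \<Rightarrow> ((real^'d \<Rightarrow> real) \<Rightarrow> real^'m) \<Rightarrow> real^'m^'m \<Rightarrow>
   real^'m \<Rightarrow> (real^'d \<Rightarrow> real) \<Rightarrow> (real^'d \<Rightarrow> real)" where
  "misfit_op \<Omega> E F \<Gamma> w = (\<lambda>f. obs_adjoint \<Omega> (Vh E) F (Gamma_dag \<Gamma> w *v F f))"

definition Hess_op ::
  "(real^'d) set \<Rightarrow> ('n::finite \<Rightarrow> (real^'d) set) \<Rightarrow> ((real^'d \<Rightarrow> real) \<Rightarrow> real^'m) \<Rightarrow> real^'m^'m \<Rightarrow>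
   real^'m \<Rightarrow> (real^'d \<Rightarrow> real) \<Rightarrow> (real^'d \<Rightarrow> real)" where
  "Hess_op \<Omega> E F \<Gamma> w q =
     op_diag \<Omega> E (misfit_op \<Omega> E F \<Gamma> w \<circ> mult_op q \<circ> misfit_op \<Omega> E F \<Gamma> w)"

definition precision_op ::
  "(real^'d) set \<Rightarrow> ('n::finite \<Rightarrow> (real^'d) set) \<Rightarrow> ((real^'d \<Rightarrow> real) \<Rightarrow> real^'m) \<Rightarrow> real^'m^'m \<Rightarrow>
   ((real^'d \<Rightarrow> real) \<Rightarrow> (real^'d \<Rightarrow> real)) \<Rightarrow>
   real^'m \<Rightarrow> (real^'d \<Rightarrow> real) \<Rightarrow> (real^'d \<Rightarrow> real)" where
  "precision_op \<Omega> E F \<Gamma> C0 w q =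
     (\<lambda>x. Hess_op \<Omega> E F \<Gamma> w q x + inv_into (Vh E) C0 q x)"

definition C_post ::
  "(real^'d) set \<Rightarrow> ('n::finite \<Rightarrow> (real^'d) set) \<Rightarrow> ((real^'d \<Rightarrow> real) \<Rightarrow> real^'m) \<Rightarrow> real^'m^'m \<Rightarrow>
   ((real^'d \<Rightarrow> real) \<Rightarrow> (real^'d \<Rightarrow> real)) \<Rightarrow>
   real^'m \<Rightarrow> (real^'d \<Rightarrow> real) \<Rightarrow> (real^'d \<Rightarrow> real)" where
  "C_post \<Omega> E F \<Gamma> C0 w = inv_into (Vh E) (precision_op \<Omega> E F \<Gamma> C0 w)"

definition A_opt ::
  "(real^'d) set \<Rightarrow> ('n::finite \<Rightarrow> (real^'d) set) \<Rightarrow> ((real^'d \<Rightarrow> real) \<Rightarrow> real^'m) \<Rightarrow> real^'m^'m \<Rightarrow>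
   ((real^'d \<Rightarrow> real) \<Rightarrow> (real^'d \<Rightarrow> real)) \<Rightarrow> real^'m \<Rightarrow> real" where
  "A_opt \<Omega> E F \<Gamma> C0 w = op_trace \<Omega> E (C_post \<Omega> E F \<Gamma> C0 w)"

section \<open>Matrix products\<close>

text \<open>Vectors of length \<open>\<ell>\<^sup>2\<close> are indexed by pairs: \<open>(i, k)\<close>, for row \<open>i\<close> and column \<open>k\<close>, stands for
  position \<open>i + (k - 1) \<ell>\<close> in the column-stacking order.\<close>

definition vec_of_mat :: "real^'l^'l \<Rightarrow> real^('l \<times> 'l)" where
  "vec_of_mat X = (\<chi> p. X $ fst p $ snd p)"

definition mat_of_vec :: "real^('l \<times> 'l) \<Rightarrow> real^'l^'l" where
  "mat_of_vec x = (\<chi> i k. x $ (i, k))"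

text \<open>The Kronecker product in the convention \<open>(A \<otimes> B) x = vec (A mat(x) B\<^sup>T)\<close>, which is
  \<open>B \<otimes> A\<close> in the more common one.\<close>

definition kron :: "real^'l^'l \<Rightarrow> real^'l^'l \<Rightarrow> real^('l \<times> 'l)^('l \<times> 'l)" where
  "kron A B = matrix (\<lambda>x. vec_of_mat (A ** mat_of_vec x ** transpose B))"

definition hadamard :: "real^'c^'r \<Rightarrow> real^'c^'r \<Rightarrow> real^'c^'r" (infixl "\<odot>" 70) where
  "A \<odot> B = (\<chi> i j. A $ i $ j * B $ i $ j)"

text \<open>\<open>khatri_rao Q\<close> is \<open>Q\<^sup>T * Q\<close>, whose \<open>j\<close>-th column stacks the products \<open>Q\<^sub>j\<^sub>k Q\<^sub>j\<^sub>i\<close>.\<close>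

definition khatri_rao :: "real^'l^'n \<Rightarrow> real^'n^('l \<times> 'l)" where
  "khatri_rao Q = (\<chi> p j. Q $ j $ snd p * Q $ j $ fst p)"

definition sum_col :: "real^'c^'r \<Rightarrow> real^'c" where
  "sum_col A = (\<chi> j. \<Sum>i\<in>UNIV. A $ i $ j)"

section \<open>Matrix factorizations\<close>

text \<open>Triangularity of a rectangular matrix compares positions in two different index types,
  so it takes the (zero-based) position functions of rows and columns as arguments.\<close>

definition pos :: "'a::{finite,linorder} \<Rightarrow> nat" where
  "pos i = card {j. j < i}"

definition pos_pair :: "'l::{finite,linorder} \<times> 'l \<Rightarrow> nat" where
  "pos_pair p = pos (fst p) + pos (snd p) * CARD('l)"

definition upper_tri :: "('r \<Rightarrow> nat) \<Rightarrow> ('c \<Rightarrow> nat) \<Rightarrow> real^'c^'r \<Rightarrow> bool" where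
  "upper_tri rpos cpos R \<longleftrightarrow> (\<forall>i j. cpos j < rpos i \<longrightarrow> R $ i $ j = 0)"

text \<open>The number of columns of \<open>Q\<close> is only bounded: both the full number \<open>min n m\<close> and the rank
  are common choices.\<close>

definition is_thin_qr ::
  "('c::finite \<Rightarrow> nat) \<Rightarrow> real^'c^'n \<Rightarrow> real^'l::{finite,linorder}^'n \<Rightarrow>
   real^'c^'l::{finite,linorder} \<Rightarrow> bool" where
  "is_thin_qr cpos X Q R \<longleftrightarrow> Q ** R = X \<and> transpose Q ** Q = mat 1 \<and>
     upper_tri pos cpos R \<and> CARD('l) \<le> CARD('c)"

definition is_cholesky :: "real^'k::{finite,linorder}^'k::{finite,linorder} \<Rightarrow>
   real^'k::{finite,linorder}^'k::{finite,linorder} \<Rightarrow> bool" where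
  "is_cholesky X D \<longleftrightarrow> X = transpose D ** D \<and> upper_tri pos pos D \<and> (\<forall>i. 0 < D $ i $ i)"

section \<open>The reduced matrices\<close>

definition C_hat :: "real^'n^'n \<Rightarrow> real^'n^'n \<Rightarrow> real^'k^'n \<Rightarrow> real^'k^'k" where
  "C_hat M C Qh = transpose Qh ** inv_sqrt_diag M ** C ** matrix_inv M ** C ** inv_sqrt_diag M ** Qh"

definition L_mat :: "real^'m^'l \<Rightarrow> real^'m \<Rightarrow> real^'l^'l" where
  "L_mat R w = R ** Diag w ** transpose R"

definition L_hat :: "real^'m^'l \<Rightarrow> real^('l \<times> 'l)^'k \<Rightarrow> real^'m \<Rightarrow> real^'k^'k" where
  "L_hat R Rh w = Rh ** kron (L_mat R w) (L_mat R w) ** transpose Rh"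

definition L_tilde ::
  "real^'m^'l \<Rightarrow> real^('l \<times> 'l)^'k \<Rightarrow> real^'k^'k \<Rightarrow> real^'m \<Rightarrow> 'k \<Rightarrow> real^'l^'l" where
  "L_tilde R Rh Dh w i = mat_of_vec (column i
     (transpose Rh ** matrix_inv (L_hat R Rh w + mat 1) ** transpose Dh))"

end

theory Submission
  imports Defs
begin

text \<open>
  In the basis of indicator functions every operator on the space is a matrix, and the theorem is
  a statement about matrices. Write \<open>W = M\<^sup>-\<^sup>1\<^sup>/\<^sup>2\<close>. The data misfit operator has the symmetrised
  matrix \<open>P = Q L Q\<^sup>T\<close> with \<open>L = R Diag(w) R\<^sup>T\<close>, and taking the diagonal of
  \<open>misfit \<circ> Diag(q) \<circ> misfit\<close> squares its entries, so the Hessian acts by \<open>W\<^sup>2 (P \<odot> P)\<close>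
  (\<open>Hess_op_acts_as\<close>). An entrywise square of a matrix \<open>Q L Q\<^sup>T\<close> factors through the
  Khatri-Rao product: \<open>P \<odot> P = K\<^sup>T (L \<otimes> L) K\<close> with \<open>K = Q\<^sup>T * Q\<close> (\<open>khatri_rao_kron\<close>).

  With \<open>X = W C W\<close> the prior covariance is similar to \<open>X\<^sup>2\<close>, and the second QR factorization
  reads \<open>Qh Rh = X W K\<^sup>T\<close>. The precision matrix is therefore similar to
  \<open>X\<^sup>-\<^sup>1 (I + Qh Lh Qh\<^sup>T) X\<^sup>-\<^sup>1\<close>. As \<open>Qh\<close> has orthonormal columns, the middle factor differs from the
  identity only on the range of \<open>Qh\<close>, and its inverse is \<open>I - Qh Qh\<^sup>T + Qh (Lh + I)\<^sup>-\<^sup>1 Qh\<^sup>T\<close>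
  (\<open>inverse_id_plus_projected\<close>). Multiplying by \<open>X\<close> from both sides and taking traces gives the
  formula for the objective at every \<open>w\<close> for which \<open>Lh + I\<close> is invertible
  (\<open>precision_inverse\<close>, \<open>trace_C_post\<close>). These \<open>w\<close> form an open set.

  Everything else rests on one identity. As \<open>L\<close> is the sum over \<open>a\<close> of \<open>w\<^sub>a r\<^sub>a r\<^sub>a\<^sup>T\<close>, where
  \<open>r\<^sub>a\<close> is the \<open>a\<close>-th column of \<open>R\<close>, the form of \<open>L v \<otimes> L w\<close> at matrices \<open>U\<close> and \<open>U'\<close> is
  the sum over \<open>a\<close> and \<open>b\<close> of \<open>v\<^sub>a w\<^sub>b (r\<^sub>a \<bullet> U r\<^sub>b) (r\<^sub>a \<bullet> U' r\<^sub>b)\<close> (\<open>kron_L_mat_form\<close>).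
  It shows that \<open>Lh\<close> is symmetric, that it is quadratic in \<open>w\<close> with the obvious derivative, and
  that it is positive semidefinite for \<open>w \<ge> 0\<close>, so that the open set above contains the unit cube.
  Inserted into \<open>d tr(B\<^sup>-\<^sup>1 K) = - tr(B\<^sup>-\<^sup>1 dB B\<^sup>-\<^sup>1 K)\<close> with \<open>B = Lh + I\<close> and
  \<open>K = Dh\<^sup>T Dh\<close>, it gives each partial derivative as minus a sum of squares with weights \<open>w\<^sub>b\<close>
  (\<open>A_opt_gradient_entry\<close>, \<open>reduced_objective_has_derivative\<close>). This is the stated gradient, and it
  is nonpositive for \<open>w \<ge> 0\<close>, whence the objective decreases along the segment from \<open>w\<close> to
  a larger \<open>w'\<close> (\<open>reduced_objective_antimono\<close>).
\<close>

section \<open>Matrix algebra\<close>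

lemma trace_mult_commute:
  fixes A :: "real^'n^'m" and B :: "real^'m^'n"
  shows "trace (A ** B) = trace (B ** A)"
  unfolding trace_def matrix_matrix_mult_def
  by (simp add: mult.commute) (rule sum.swap)

lemma matrix_add_distrib:
  fixes A B :: "real^'n^'m" and C :: "real^'p^'n"
  shows "(A + B) ** C = A ** C + B ** C"
  by (simp add: matrix_matrix_mult_def vec_eq_iff sum.distrib distrib_right)

lemma matrix_diff_distrib:
  fixes A B :: "real^'n^'m" and C :: "real^'p^'n"
  shows "(A - B) ** C = A ** C - B ** C"
  by (simp add: matrix_matrix_mult_def vec_eq_iff sum_subtractf left_diff_distrib)

lemma matrix_diff_distrib2:
  fixes A :: "real^'n^'m" and B C :: "real^'p^'n"
  shows "A ** (B - C) = A ** B - A ** C"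
  by (simp add: matrix_matrix_mult_def vec_eq_iff sum_subtractf right_diff_distrib)

lemma matrix_inv_eqI:
  fixes A B :: "real^'n^'n"
  assumes "A ** B = mat 1"
  shows "invertible A" "matrix_inv A = B"
proof -
  have BA: "B ** A = mat 1"
    using assms matrix_left_right_inverse by blast
  then show inv: "invertible A"
    using assms by (auto simp: invertible_def)
  have "A ** matrix_inv A = mat 1 \<and> matrix_inv A ** A = mat 1"
    unfolding matrix_inv_def
    by (rule someI[where x=B]) (use assms BA in auto)
  then show "matrix_inv A = B"
    by (metis BA matrix_mul_assoc matrix_mul_lid matrix_mul_rid)
qed

lemma matrix_inv_mult:
  fixes A :: "real^'n^'n"
  assumes "invertible A"
  shows "A ** matrix_inv A = mat 1" "matrix_inv A ** A = mat 1"
proof -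
  obtain B where "A ** B = mat 1" "B ** A = mat 1"
    using assms by (auto simp: invertible_def)
  with matrix_inv_eqI[of A B] show "A ** matrix_inv A = mat 1" "matrix_inv A ** A = mat 1"
    by auto
qed

lemma inner_transpose_mult: "(transpose A *v x) \<bullet> y = x \<bullet> (A *v (y::real^'n))"
  by (metis dot_lmul_matrix vector_transpose_matrix transpose_matrix_vector)

lemma transpose_add: "transpose (A + B) = transpose A + transpose B"
  by (simp add: vec_eq_iff transpose_def)

lemma matrix_sum_vector_mult: "(\<Sum>i\<in>I. A i) *v x = (\<Sum>i\<in>I. A i *v x)" for x :: "real^'n"
  by (induction I rule: infinite_finite_induct) (auto simp: matrix_vector_mult_add_rdistrib)

lemma column_mult: "column i (A ** B) = A *v column i B"
  by (simp add: vec_eq_iff column_def matrix_matrix_mult_def matrix_vector_mult_def)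

lemma trace_congruence:
  fixes A :: "real^'n^'n" and Y :: "real^'k^'n"
  shows "trace (transpose Y ** A ** Y) = (\<Sum>i\<in>UNIV. column i Y \<bullet> (A *v column i Y))"
  unfolding matrix_mul_assoc[symmetric]
  by (simp add: trace_def matrix_matrix_mult_def transpose_def column_def inner_vec_def
      matrix_vector_mult_def)

lemma transpose_matrix_inv:
  fixes A :: "real^'n^'n"
  assumes "invertible A" "transpose A = A"
  shows "transpose (matrix_inv A) = matrix_inv A"
proof -
  have "A ** transpose (matrix_inv A) = transpose (matrix_inv A ** A)"
    by (simp add: matrix_transpose_mul assms)
  also have "\<dots> = mat 1"
    by (simp add: matrix_inv_mult assms transpose_mat)
  finally show ?thesis
    using matrix_inv_eqI(2) by metis
qed

lemma invertible_of_pos_def: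
  fixes A :: "real^'n^'n"
  assumes "\<And>x. x \<noteq> 0 \<Longrightarrow> 0 < x \<bullet> (A *v x)"
  shows "invertible A"
proof -
  have "A *v x = 0 \<Longrightarrow> x = 0" for x
    using assms[of x] by fastforce
  then show ?thesis
    by (simp add: invertible_left_inverse matrix_left_invertible_ker)
qed

lemma Diag_mult_left: "(Diag v ** A) $ i $ j = v $ i * A $ i $ j"
  by (simp add: matrix_matrix_mult_def Diag_def if_distrib[where f="\<lambda>u. u * _"] sum.delta'
      cong: if_cong)

lemma Diag_mult_right: "(A ** Diag v) $ i $ j = A $ i $ j * v $ j"
  by (simp add: matrix_matrix_mult_def Diag_def if_distrib[where f="\<lambda>u. _ * u"] sum.delta
      cong: if_cong)

lemma Diag_mult_vec: "Diag v *v x = (\<chi> i. v $ i * x $ i)"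
  by (simp add: vec_eq_iff matrix_vector_mult_def Diag_def if_distrib[where f="\<lambda>u. u * _"] sum.delta'
      cong: if_cong)

lemma transpose_Diag: "transpose (Diag v) = Diag v"
  by (auto simp: vec_eq_iff transpose_def Diag_def)

lemma Diag_mult_Diag: "Diag u ** Diag v = Diag (\<chi> i. u $ i * v $ i)"
  by (simp add: vec_eq_iff Diag_mult_left) (simp add: Diag_def)

lemma Diag_one: "Diag (\<chi> i. 1) = mat 1"
  by (simp add: vec_eq_iff Diag_def mat_def)

section \<open>Differentiating the inverse of a matrix\<close>

text \<open>Cramer's rule. It is needed only to see that the inverse depends differentiably on the
  matrix.\<close>
lemma matrix_inv_entry:
  fixes A :: "real^'n^'n"
  assumes "invertible A"
  shows "matrix_inv A $ i $ j
    = det (\<chi> p q. if q = i then axis j 1 $ p else A $ p $ q) / det A"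
proof -
  have "A *v (matrix_inv A *v axis j 1) = axis j 1"
    by (simp add: matrix_vector_mul_assoc matrix_inv_mult assms)
  then have "matrix_inv A *v axis j 1
    = (\<chi> k. det (\<chi> p q. if q = k then axis j 1 $ p else A $ p $ q) / det A)"
    using cramer[of A] assms by (simp add: invertible_det_nz)
  moreover have "(matrix_inv A *v axis j 1) $ i = matrix_inv A $ i $ j"
    by (simp add: matrix_vector_mult_basis column_def)
  ultimately show ?thesis
    by simp
qed

lemma differentiable_det:
  fixes A :: "'a::real_normed_vector \<Rightarrow> real^'n^'n"
  assumes "\<And>i j. (\<lambda>y. A y $ i $ j) differentiable (at x)"
  shows "(\<lambda>y. det (A y)) differentiable (at x)"
proof -
  have "(\<lambda>y. \<Prod>i\<in>UNIV. A y $ i $ p i) differentiable (at x)" for p :: "'n \<Rightarrow> 'n"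
  proof -
    from has_derivative_prod[of UNIV "\<lambda>i y. A y $ i $ p i",
        OF assms[unfolded frechet_derivative_works]]
    show ?thesis
      unfolding differentiable_def by blast
  qed
  then show ?thesis
    unfolding det_def by (simp add: finite_permutations)
qed

lemma open_invertible:
  fixes A :: "'a::real_normed_vector \<Rightarrow> real^'n^'n"
  assumes "\<And>x. A differentiable (at x)"
  shows "open {x. invertible (A x)}"
proof -
  have ent: "(\<lambda>y. A y $ i $ j) differentiable (at x)" for i j x
    using assms[of x] unfolding differentiable_def
    by (metis bounded_linear.has_derivative[OF bounded_linear_vec_nth])
  have "continuous_on UNIV (\<lambda>x. det (A x))"
    by (intro differentiable_imp_continuous_on)
       (simp add: differentiable_on_def differentiable_det ent)
  then have "open {x. det (A x) \<noteq> 0}"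
    by (intro open_Collect_neq) auto
  then show ?thesis
    by (simp add: invertible_det_nz)
qed

text \<open>The resolvent identity \<open>A y\<^sup>-\<^sup>1 = A x\<^sup>-\<^sup>1 - A y\<^sup>-\<^sup>1 (A y - A x) A x\<^sup>-\<^sup>1\<close> writes the difference as
  a product in which the factor \<open>A y - A x\<close> vanishes at \<open>x\<close>. The product rule therefore leaves only
  the term with the derivative of \<open>A\<close>, and of the factor \<open>A y\<^sup>-\<^sup>1\<close> only differentiability matters.\<close>
lemma has_derivative_trace_matrix_inv:
  fixes A :: "'a::real_normed_vector \<Rightarrow> real^'n^'n" and K :: "real^'n^'n"
  assumes A: "\<And>y. A differentiable (at y)" and der: "(A has_derivative A') (at x)"
    and inv: "invertible (A x)"
  shows "((\<lambda>y. trace (matrix_inv (A y) ** K)) has_derivative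
    (\<lambda>v. - trace (matrix_inv (A x) ** A' v ** matrix_inv (A x) ** K))) (at x)"
proof -
  have ent: "((\<lambda>y. A y $ i $ j) has_derivative (\<lambda>v. A' v $ i $ j)) (at x)" for i j
    using bounded_linear.has_derivative[OF bounded_linear_vec_nth
        bounded_linear.has_derivative[OF bounded_linear_vec_nth der]] .
  have ent_d: "(\<lambda>y. A y $ i $ j) differentiable (at x)" for i j
    using ent unfolding differentiable_def by blast
  let ?B = "\<lambda>i j y. det (\<chi> p q. if q = i then axis j 1 $ p else A y $ p $ q) / det (A y)"
  have B_d: "?B i j differentiable (at x)" for i j
  proof (rule differentiable_divide)
    show "(\<lambda>y. det (\<chi> p q. if q = i then axis j 1 $ p else A y $ p $ q)) differentiable (at x)"
    proof (rule differentiable_det)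
      fix p q
      show "(\<lambda>y. (\<chi> p q. if q = i then axis j 1 $ p else A y $ p $ q) $ p $ q)
          differentiable (at x)"
        by (cases "q = i") (simp_all add: ent_d)
    qed
    show "(\<lambda>y. det (A y)) differentiable (at x)"
      by (rule differentiable_det) (rule ent_d)
    show "det (A x) \<noteq> 0"
      using inv by (simp add: invertible_det_nz)
  qed
  note B' = B_d[unfolded frechet_derivative_works]
  define G where "G = matrix_inv (A x) ** K"
  have step: "trace (matrix_inv (A y) ** K)
      = trace (matrix_inv (A x) ** K) - (\<Sum>i\<in>UNIV. \<Sum>j\<in>UNIV. \<Sum>k\<in>UNIV.
          ?B i j y * ((A y $ j $ k - A x $ j $ k) * G $ k $ i))" if "invertible (A y)" for y
  proof -
    have "matrix_inv (A y) ** K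
        = matrix_inv (A x) ** K - matrix_inv (A y) ** ((A y - A x) ** G)"
      unfolding G_def
      by (simp add: matrix_diff_distrib matrix_diff_distrib2 matrix_mul_assoc
          matrix_inv_mult that)
         (simp add: matrix_mul_assoc[symmetric] matrix_inv_mult inv)
    moreover have "trace (matrix_inv (A y) ** ((A y - A x) ** G))
       = (\<Sum>i\<in>UNIV. \<Sum>j\<in>UNIV. \<Sum>k\<in>UNIV. ?B i j y * ((A y $ j $ k - A x $ j $ k) * G $ k $ i))"
      by (simp add: trace_def matrix_matrix_mult_def sum_distrib_left matrix_inv_entry[OF that])
    ultimately show ?thesis
      by (simp add: trace_sub)
  qed
  have "((\<lambda>y. trace (matrix_inv (A x) ** K) - (\<Sum>i\<in>UNIV. \<Sum>j\<in>UNIV. \<Sum>k\<in>UNIV.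
          ?B i j y * ((A y $ j $ k - A x $ j $ k) * G $ k $ i))) has_derivative
      (\<lambda>v. - (\<Sum>i\<in>UNIV. \<Sum>j\<in>UNIV. \<Sum>k\<in>UNIV. ?B i j x * (A' v $ j $ k * G $ k $ i)))) (at x)"
    by (rule has_derivative_subst,
        (rule has_derivative_diff has_derivative_const has_derivative_sum has_derivative_mult
          has_derivative_mult_left B' ent)+) simp
  also have "(\<lambda>v. - (\<Sum>i\<in>UNIV. \<Sum>j\<in>UNIV. \<Sum>k\<in>UNIV. ?B i j x * (A' v $ j $ k * G $ k $ i)))
     = (\<lambda>v. - trace (matrix_inv (A x) ** (A' v ** G)))"
    by (simp add: trace_def matrix_matrix_mult_def sum_distrib_left matrix_inv_entry[OF inv])
  also have "\<dots> = (\<lambda>v. - trace (matrix_inv (A x) ** A' v ** matrix_inv (A x) ** K))"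
    by (simp add: G_def matrix_mul_assoc)
  finally show ?thesis
  proof (rule has_derivative_transform_within_open[OF _ open_invertible[OF A]])
    show "x \<in> {x. invertible (A x)}"
      using inv by simp
  qed (rule step[symmetric], simp)
qed

section \<open>Piecewise constant functions and the matrices of operators\<close>

definition fe_fun :: "('n::finite \<Rightarrow> (real^'d) set) \<Rightarrow> real^'n \<Rightarrow> real^'d \<Rightarrow> real" where
  "fe_fun E g = (\<lambda>x. \<Sum>i\<in>UNIV. g $ i * indicator (E i) x)"

text \<open>The matrix acting on coefficient vectors, that is \<open>M\<^sup>-\<^sup>1\<close> times \<open>op_mat\<close> (\<open>acts_as_op_mat\<close>).
  In this form composition, sums and inverses of operators become those of matrices.\<close>
definition acts_as ::
  "('n::finite \<Rightarrow> (real^'d) set) \<Rightarrow> ((real^'d \<Rightarrow> real) \<Rightarrow> (real^'d \<Rightarrow> real)) \<Rightarrow> real^'n^'n \<Rightarrow> bool" where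
  "acts_as E A T \<longleftrightarrow> (\<forall>g. A (fe_fun E g) = fe_fun E (T *v g))"

lemma Vh_eq_range: "Vh E = range (fe_fun E)"
  by (auto simp: Vh_def fe_fun_def[abs_def])

lemma fe_fun_in_Vh [simp]: "fe_fun E g \<in> Vh E"
  by (simp add: Vh_eq_range)

lemma fe_fun_linear:
  "fe_fun E (a *\<^sub>R g + b *\<^sub>R h) = (\<lambda>x. a * fe_fun E g x + b * fe_fun E h x)"
  by (simp add: fe_fun_def fun_eq_iff sum.distrib sum_distrib_left algebra_simps
      del: sum_mult_indicator)

lemma fe_fun_add: "fe_fun E (g + h) = (\<lambda>x. fe_fun E g x + fe_fun E h x)"
  using fe_fun_linear[of E 1 g 1 h] by simp

lemma fe_fun_axis: "fe_fun E (axis j 1) = indicator (E j)"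
  by (simp add: fe_fun_def fun_eq_iff axis_def if_distrib[where f="\<lambda>u. u * _"] sum.delta'
      cong: if_cong)

lemma acts_as_comp:
  assumes "acts_as E A T" "acts_as E B U"
  shows "acts_as E (A \<circ> B) (T ** U)"
  using assms by (simp add: acts_as_def matrix_vector_mul_assoc)

lemma linear_eq_matrix:
  fixes f :: "real^'n \<Rightarrow> real^'m"
  assumes "\<And>g h a b. f (a *\<^sub>R g + b *\<^sub>R h) = a *\<^sub>R f g + b *\<^sub>R f h"
  shows "f g = matrix f *v g"
proof -
  have "linear f"
    using assms[of 1 _ 1] assms[of _ _ 0] by (intro linearI) simp_all
  then show ?thesis
    by (simp add: matrix_works)
qed

lemma lin_obs_matrix:
  assumes "lin_obs (Vh E) F"
  shows "F (fe_fun E g) = obs_mat E F *v g"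
proof -
  have "F (fe_fun E g) = matrix (\<lambda>g. F (fe_fun E g)) *v g"
    by (rule linear_eq_matrix[of "\<lambda>g. F (fe_fun E g)"])
       (use assms in \<open>simp add: fe_fun_linear lin_obs_def\<close>)
  also have "matrix (\<lambda>g. F (fe_fun E g)) = obs_mat E F"
    by (simp add: matrix_def obs_mat_def fe_fun_axis)
  finally show ?thesis .
qed

context
  fixes \<Omega> :: "(real^'d) set" and E :: "'n::finite \<Rightarrow> (real^'d) set"
  assumes mesh: "is_mesh \<Omega> E"
begin

lemma measure_pos: "0 < measure lebesgue (E i)"
  using mesh by (simp add: is_mesh_def)

lemma fe_fun_at: "x \<in> E i \<Longrightarrow> fe_fun E g x = g $ i"
proof -
  assume "x \<in> E i"
  then have "indicator (E j) x = (if j = i then 1 else 0 :: real)" for j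
    using mesh by (auto simp: is_mesh_def disjoint_family_on_def indicator_def)
  then show ?thesis
    by (simp add: fe_fun_def if_distrib[where f="\<lambda>u. _ * u"] sum.delta' del: sum_mult_indicator
        cong: if_cong)
qed

lemma fe_fun_outside: "x \<notin> \<Omega> \<Longrightarrow> fe_fun E g x = 0"
  using mesh by (auto simp: fe_fun_def is_mesh_def)

lemma fe_fun_eqI:
  assumes "\<And>i x. x \<in> E i \<Longrightarrow> f x = g $ i" "\<And>x. x \<notin> \<Omega> \<Longrightarrow> f x = 0"
  shows "f = fe_fun E g"
proof
  fix x show "f x = fe_fun E g x"
  proof (cases "x \<in> \<Omega>")
    case True
    then obtain i where "x \<in> E i"
      using mesh by (auto simp: is_mesh_def)
    then show ?thesis
      by (simp add: assms fe_fun_at)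
  qed (simp add: assms fe_fun_outside)
qed

lemma fe_fun_inject: "fe_fun E g = fe_fun E h \<longleftrightarrow> g = h"
proof
  assume eq: "fe_fun E g = fe_fun E h"
  have "g $ i = h $ i" for i
  proof -
    have "E i \<noteq> {}"
      using measure_pos[of i] by auto
    then obtain x where "x \<in> E i" by auto
    then show ?thesis
      using eq fe_fun_at by metis
  qed
  then show "g = h"
    by (simp add: vec_eq_iff)
qed simp

lemma mult_op_acts_as: "acts_as E (mult_op (fe_fun E q)) (Diag q)"
  unfolding acts_as_def mult_op_def
  by (intro allI fe_fun_eqI) (simp_all add: fe_fun_at fe_fun_outside Diag_mult_vec)

lemma l2_inner_fe_fun: "l2_inner \<Omega> (fe_fun E g) (fe_fun E h) = g \<bullet> (mass_mat E *v h)"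
proof -
  have "(\<lambda>x. indicator \<Omega> x *\<^sub>R (fe_fun E g x * fe_fun E h x)) = fe_fun E (\<chi> i. g $ i * h $ i)"
  proof (rule fe_fun_eqI)
    fix i x assume "x \<in> E i"
    moreover from this have "x \<in> \<Omega>"
      using mesh by (auto simp: is_mesh_def)
    ultimately show "indicator \<Omega> x *\<^sub>R (fe_fun E g x * fe_fun E h x) = (\<chi> i. g $ i * h $ i) $ i"
      by (simp add: fe_fun_at)
  qed simp
  then have "l2_inner \<Omega> (fe_fun E g) (fe_fun E h)
      = (LINT x|lebesgue. fe_fun E (\<chi> i. g $ i * h $ i) x)"
    by (simp add: l2_inner_def set_lebesgue_integral_def)
  also have "\<dots> = (\<Sum>i\<in>UNIV. g $ i * h $ i * measure lebesgue (E i))"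
  proof -
    have "integrable lebesgue (indicator (E i) :: _ \<Rightarrow> real)" for i
      using mesh by (simp add: is_mesh_def lmeasurable_iff_integrable)
    then show ?thesis
      by (simp add: fe_fun_def del: sum_mult_indicator)
  qed
  finally show ?thesis
    by (simp add: inner_vec_def mass_mat_def Diag_mult_vec ac_simps)
qed

lemma lin_op_acts_as:
  assumes "lin_op (Vh E) A"
  shows "\<exists>T. acts_as E A T"
proof -
  have "\<forall>g. \<exists>h. A (fe_fun E g) = fe_fun E h"
    using assms by (simp add: lin_op_def Vh_eq_range image_iff)
  then obtain f where f: "\<And>g. A (fe_fun E g) = fe_fun E (f g)"
    by metis
  have "fe_fun E (f (a *\<^sub>R g + b *\<^sub>R h)) = fe_fun E (a *\<^sub>R f g + b *\<^sub>R f h)" for a b g h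
    using assms by (simp add: f[symmetric] fe_fun_linear lin_op_def)
  then have "f g = matrix f *v g" for g
    by (intro linear_eq_matrix) (simp add: fe_fun_inject)
  with f have "acts_as E A (matrix f)"
    by (metis acts_as_def)
  then show ?thesis ..
qed

lemma op_mat_eq:
  assumes "acts_as E A T"
  shows "op_mat \<Omega> E A = mass_mat E ** T"
proof -
  have "op_mat \<Omega> E A $ i $ j = (mass_mat E ** T) $ i $ j" for i j
  proof -
    have "op_mat \<Omega> E A $ i $ j = (T *v axis j 1) \<bullet> (mass_mat E *v axis i 1)"
      using assms by (simp add: op_mat_def fe_fun_axis[symmetric] acts_as_def l2_inner_fe_fun)
    also have "\<dots> = T $ i $ j * measure lebesgue (E i)"
      by (simp add: mass_mat_def matrix_vector_mult_basis inner_vec_def column_def Diag_def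
          if_distrib[where f="\<lambda>u. _ * u"] sum.delta cong: if_cong)
    also have "\<dots> = (mass_mat E ** T) $ i $ j"
      by (simp add: mass_mat_def Diag_mult_left)
    finally show ?thesis .
  qed
  then show ?thesis
    by (simp add: vec_eq_iff)
qed

lemma mass_mat_inv:
  "mass_mat E ** matrix_inv (mass_mat E) = mat 1" "matrix_inv (mass_mat E) ** mass_mat E = mat 1"
  "matrix_inv (mass_mat E) = Diag (\<chi> i. 1 / measure lebesgue (E i))"
proof -
  have "mass_mat E ** Diag (\<chi> i. 1 / measure lebesgue (E i)) = mat 1"
    using measure_pos by (simp add: mass_mat_def Diag_mult_Diag Diag_one[symmetric] less_imp_neq[symmetric])
  note inv = matrix_inv_eqI[OF this]
  from inv(2) matrix_inv_mult[OF inv(1)]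
  show "mass_mat E ** matrix_inv (mass_mat E) = mat 1"
      "matrix_inv (mass_mat E) ** mass_mat E = mat 1"
      "matrix_inv (mass_mat E) = Diag (\<chi> i. 1 / measure lebesgue (E i))"
    by blast+
qed

lemma acts_as_op_mat:
  assumes "acts_as E A T"
  shows "T = matrix_inv (mass_mat E) ** op_mat \<Omega> E A"
  by (simp add: op_mat_eq[OF assms] matrix_mul_assoc mass_mat_inv(1,2))

lemma op_trace_eq:
  assumes "acts_as E A T"
  shows "op_trace \<Omega> E A = trace T"
  using acts_as_op_mat[OF assms] by (simp add: op_trace_def)

lemma self_adjoint_op_mat:
  assumes "self_adjoint_op \<Omega> (Vh E) A"
  shows "transpose (op_mat \<Omega> E A) = op_mat \<Omega> E A"
proof -
  have sym: "l2_inner \<Omega> f g = l2_inner \<Omega> g f" for f g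
    by (simp add: l2_inner_def mult.commute)
  have "l2_inner \<Omega> (A (indicator (E i))) (indicator (E j))
      = l2_inner \<Omega> (A (indicator (E j))) (indicator (E i))" for i j
    using assms fe_fun_in_Vh[of E "axis _ 1", unfolded fe_fun_axis]
    by (metis self_adjoint_op_def sym)
  then show ?thesis
    by (simp add: vec_eq_iff transpose_def op_mat_def)
qed

lemma pos_def_op_invertible:
  assumes "acts_as E A T" "pos_def_op \<Omega> (Vh E) A"
  shows "invertible T"
proof -
  have "x = 0" if "T *v x = 0" for x
  proof (rule ccontr)
    assume "x \<noteq> 0"
    have zero: "fe_fun E 0 = (\<lambda>_. 0)"
      by (simp add: fe_fun_def)
    then have "fe_fun E x \<noteq> (\<lambda>_. 0)"
      using \<open>x \<noteq> 0\<close> fe_fun_inject[of x 0] by metis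
    then have "0 < l2_inner \<Omega> (A (fe_fun E x)) (fe_fun E x)"
      using assms(2) by (simp add: pos_def_op_def)
    also have "\<dots> = l2_inner \<Omega> (fe_fun E 0) (fe_fun E x)"
      using assms(1) that by (simp add: acts_as_def)
    finally show False
      by (simp add: l2_inner_fe_fun)
  qed
  then show ?thesis
    by (simp add: invertible_left_inverse matrix_left_invertible_ker)
qed

lemma inv_into_acts_as:
  assumes A: "acts_as E A T" and T: "invertible T"
  shows "bij_betw A (Vh E) (Vh E)" "acts_as E (inv_into (Vh E) A) (matrix_inv T)"
proof -
  let ?U = "matrix_inv T"
  have right: "A (fe_fun E (?U *v g)) = fe_fun E g" for g
    using A by (simp add: acts_as_def matrix_vector_mul_assoc matrix_inv_mult T)
  have inj: "inj_on A (Vh E)"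
  proof (rule inj_onI)
    fix f f' assume "f \<in> Vh E" "f' \<in> Vh E" "A f = A f'"
    then obtain g g' where g: "f = fe_fun E g" "f' = fe_fun E g'"
      by (auto simp: Vh_eq_range)
    with \<open>A f = A f'\<close> have "T *v g = T *v g'"
      using A by (simp add: acts_as_def fe_fun_inject)
    then have "?U *v (T *v g) = ?U *v (T *v g')"
      by simp
    then show "f = f'"
      by (simp add: g matrix_vector_mul_assoc matrix_inv_mult T)
  qed
  have "A ` Vh E = Vh E"
  proof
    show "A ` Vh E \<subseteq> Vh E"
      using A by (auto simp: Vh_eq_range acts_as_def)
    show "Vh E \<subseteq> A ` Vh E"
    proof
      fix f assume "f \<in> Vh E"
      then obtain g where "f = A (fe_fun E (?U *v g))"
        by (auto simp: Vh_eq_range right)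
      then show "f \<in> A ` Vh E"
        by simp
    qed
  qed
  with inj show "bij_betw A (Vh E) (Vh E)"
    by (simp add: bij_betw_def)
  show "acts_as E (inv_into (Vh E) A) ?U"
    unfolding acts_as_def
    by (intro allI inv_into_f_eq[OF inj]) (simp_all add: right)
qed

text \<open>The kernel is \<open>M\<^sup>-\<^sup>1 (M T) M\<^sup>-\<^sup>1 = T M\<^sup>-\<^sup>1\<close> in the basis of indicators, which accounts for the
  division by the measure.\<close>
lemma op_diag_eq:
  assumes "acts_as E A T"
  shows "op_diag \<Omega> E A = fe_fun E (\<chi> i. T $ i $ i / measure lebesgue (E i))"
proof (rule fe_fun_eqI)
  fix i x assume x: "x \<in> E i"
  have ind: "indicator (E j) x = (if j = i then 1 else 0 :: real)" for j
    using fe_fun_at[OF x, of "axis j 1"] unfolding fe_fun_axis by (simp add: axis_def)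
  have "op_diag \<Omega> E A x = (\<Sum>k\<in>UNIV. \<Sum>j\<in>UNIV.
      if j = i then if k = i then T $ i $ i / measure lebesgue (E i) else 0 else 0)"
    unfolding op_diag_def op_kernel_def op_mat_eq[OF assms] mass_mat_def Diag_mult_left
    using measure_pos[of i] by (intro sum.cong refl) (auto simp: ind field_simps)
  then show "op_diag \<Omega> E A x = (\<chi> i. T $ i $ i / measure lebesgue (E i)) $ i"
    by simp
next
  fix x assume "x \<notin> \<Omega>"
  then show "op_diag \<Omega> E A x = 0"
    using mesh by (simp add: op_diag_def op_kernel_def is_mesh_def)
qed

text \<open>Nondegeneracy of the inner product on \<open>Vh E\<close> makes the definite description in the
  adjoint well defined.\<close>
lemma obs_adjoint_eq:
  assumes "lin_obs (Vh E) F"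
  shows "obs_adjoint \<Omega> (Vh E) F y
    = fe_fun E ((matrix_inv (mass_mat E) ** transpose (obs_mat E F)) *v y)"
    (is "_ = fe_fun E ?u")
  unfolding obs_adjoint_def
proof (rule the_equality)
  let ?M = "mass_mat E"
  have M: "transpose ?M = ?M"
    by (simp add: mass_mat_def transpose_Diag)
  have inner: "l2_inner \<Omega> (fe_fun E g) (fe_fun E h) = (?M *v g) \<bullet> h" for g h
    using inner_transpose_mult[of ?M g h] by (simp add: l2_inner_fe_fun M del: transpose_matrix_vector)
  have obs: "y \<bullet> F (fe_fun E h) = (transpose (obs_mat E F) *v y) \<bullet> h" for h
    by (simp add: lin_obs_matrix[OF assms] inner_transpose_mult del: transpose_matrix_vector)
  have Mu: "?M *v ?u = transpose (obs_mat E F) *v y"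
    by (simp add: matrix_vector_mul_assoc matrix_mul_assoc mass_mat_inv(1,2)
        del: transpose_matrix_vector)
  show "fe_fun E ?u \<in> Vh E \<and> (\<forall>f\<in>Vh E. l2_inner \<Omega> (fe_fun E ?u) f = y \<bullet> F f)"
    by (auto simp: Vh_eq_range inner obs Mu simp del: transpose_matrix_vector)
  fix g assume g: "g \<in> Vh E \<and> (\<forall>f\<in>Vh E. l2_inner \<Omega> g f = y \<bullet> F f)"
  then obtain v where v: "g = fe_fun E v"
    by (auto simp: Vh_eq_range)
  have "(?M *v v) \<bullet> h = (?M *v ?u) \<bullet> h" for h
    using g unfolding v Mu obs[symmetric] inner[symmetric] by simp
  then have "?M *v v = ?M *v ?u"
    using vector_eq_rdot by blast
  then have "matrix_inv ?M *v (?M *v v) = matrix_inv ?M *v (?M *v ?u)"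
    by simp
  then show "g = fe_fun E ?u"
    by (simp add: v matrix_vector_mul_assoc matrix_mul_assoc mass_mat_inv(1,2)
        del: transpose_matrix_vector)
qed

lemma misfit_op_acts_as:
  assumes "lin_obs (Vh E) F"
  shows "acts_as E (misfit_op \<Omega> E F \<Gamma> w) (matrix_inv (mass_mat E) **
    (transpose (obs_mat E F) ** Gamma_dag \<Gamma> w ** obs_mat E F))"
  unfolding acts_as_def misfit_op_def
  by (simp add: obs_adjoint_eq[OF assms] lin_obs_matrix[OF assms] matrix_vector_mul_assoc
      matrix_mul_assoc del: transpose_matrix_vector)

text \<open>With \<open>B = F\<^sup>T \<Gamma>\<^sup>\<dagger> F\<close> the diagonal entry of \<open>M\<^sup>-\<^sup>1 B Diag(q) M\<^sup>-\<^sup>1 B\<close> at \<open>i\<close> is the sum over \<open>j\<close> of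
  \<open>B\<^sub>i\<^sub>j B\<^sub>j\<^sub>i q\<^sub>j / (m\<^sub>i m\<^sub>j)\<close>. Since \<open>B\<close> is symmetric, the coefficients are the squared entries of
  \<open>P = W B W\<close>.\<close>
lemma Hess_op_acts_as:
  fixes F :: "(real^'d \<Rightarrow> real) \<Rightarrow> real^'m" and w :: "real^'m" and \<Gamma> :: "real^'m^'m"
  assumes F: "lin_obs (Vh E) F"
  defines "W \<equiv> inv_sqrt_diag (mass_mat E)"
  defines "P \<equiv> W ** transpose (obs_mat E F) ** Gamma_dag \<Gamma> w ** obs_mat E F ** W"
  shows "acts_as E (Hess_op \<Omega> E F \<Gamma> w) (matrix_inv (mass_mat E) ** (P \<odot> P))"
proof -
  let ?m = "\<lambda>i. measure lebesgue (E i)"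
  define B where "B = transpose (obs_mat E F) ** Gamma_dag \<Gamma> w ** obs_mat E F"
  have "transpose (Gamma_dag \<Gamma> w) = Gamma_dag \<Gamma> w"
    by (simp add: Gamma_dag_def inv_sqrt_diag_def matrix_transpose_mul transpose_Diag matrix_mul_assoc)
  then have "transpose B = B"
    by (simp add: B_def matrix_transpose_mul matrix_mul_assoc)
  then have sym: "B $ i $ j = B $ j $ i" for i j
    by (metis transpose_def vec_lambda_beta)
  have "P = W ** B ** W"
    by (simp add: P_def B_def matrix_mul_assoc)
  then have P: "P $ i $ j = B $ i $ j / (sqrt (?m i) * sqrt (?m j))" for i j
    by (simp add: W_def inv_sqrt_diag_def Diag_mult_left Diag_mult_right mass_mat_def)
       (simp add: Diag_def)
  have PP: "(P \<odot> P) $ i $ j = (B $ i $ j)\<^sup>2 / (?m i * ?m j)" for i j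
    using measure_pos[of i] measure_pos[of j]
    by (simp add: hadamard_def P power2_eq_square[symmetric] power_divide power_mult_distrib)
  have "Hess_op \<Omega> E F \<Gamma> w (fe_fun E q) = fe_fun E ((matrix_inv (mass_mat E) ** (P \<odot> P)) *v q)" for q
  proof -
    let ?T = "matrix_inv (mass_mat E) ** B"
    have "(?T ** Diag q ** ?T) $ i $ i = (\<Sum>j\<in>UNIV. (B $ i $ j)\<^sup>2 / (?m i * ?m j) * q $ j)" for i
    proof -
      have "(?T ** Diag q ** ?T) $ i $ i = (\<Sum>j\<in>UNIV. (?T ** Diag q) $ i $ j * ?T $ j $ i)"
        by (simp add: matrix_matrix_mult_def)
      then show ?thesis
        by (simp add: Diag_mult_right mass_mat_inv(3) Diag_mult_left sym[of _ i] power2_eq_square ac_simps)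
    qed
    then have "Hess_op \<Omega> E F \<Gamma> w (fe_fun E q)
       = fe_fun E (\<chi> i. (\<Sum>j\<in>UNIV. (P \<odot> P) $ i $ j * q $ j) / ?m i)"
      unfolding Hess_op_def
      by (subst op_diag_eq[OF acts_as_comp[OF acts_as_comp[OF misfit_op_acts_as[OF F]
              mult_op_acts_as] misfit_op_acts_as[OF F]]])
         (simp add: B_def[symmetric] PP)
    also have "(\<chi> i. (\<Sum>j\<in>UNIV. (P \<odot> P) $ i $ j * q $ j) / ?m i)
       = (matrix_inv (mass_mat E) ** (P \<odot> P)) *v q"
      by (simp add: vec_eq_iff matrix_vector_mult_def mass_mat_inv(3) Diag_mult_left sum_divide_distrib)
    finally show ?thesis .
  qed
  then show ?thesis
    by (simp add: acts_as_def)
qed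

lemma inv_sqrt_mass:
  "inv_sqrt_diag (mass_mat E) ** inv_sqrt_diag (mass_mat E) = matrix_inv (mass_mat E)"
  "Diag (\<chi> i. sqrt (measure lebesgue (E i))) ** inv_sqrt_diag (mass_mat E) = mat 1"
  "transpose (inv_sqrt_diag (mass_mat E)) = inv_sqrt_diag (mass_mat E)"
proof -
  have W: "inv_sqrt_diag (mass_mat E) = Diag (\<chi> i. 1 / sqrt (measure lebesgue (E i)))"
    by (simp add: inv_sqrt_diag_def mass_mat_def) (simp add: Diag_def)
  have m: "0 < measure lebesgue (E i)" "measure lebesgue (E i) \<noteq> 0" for i
    using measure_pos[of i] by auto
  show "inv_sqrt_diag (mass_mat E) ** inv_sqrt_diag (mass_mat E) = matrix_inv (mass_mat E)"
    "Diag (\<chi> i. sqrt (measure lebesgue (E i))) ** inv_sqrt_diag (mass_mat E) = mat 1"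
    "transpose (inv_sqrt_diag (mass_mat E)) = inv_sqrt_diag (mass_mat E)"
    using m less_imp_le[OF m(1)]
    by (simp_all add: W transpose_Diag Diag_mult_Diag mass_mat_inv(3) Diag_one[symmetric])
qed

end

section \<open>Kronecker products of the data matrices\<close>

lemma L_mat_form:
  "x \<bullet> (L_mat R w *v y) = (\<Sum>a\<in>UNIV. w $ a * ((x \<bullet> column a R) * (column a R \<bullet> y)))"
proof -
  have "L_mat R w *v y = R *v (Diag w *v (transpose R *v y))"
    by (simp add: L_mat_def matrix_vector_mul_assoc matrix_mul_assoc del: transpose_matrix_vector)
  also have "x \<bullet> \<dots> = (transpose R *v x) \<bullet> (Diag w *v (transpose R *v y))"
    by (metis dot_lmul_matrix vector_transpose_matrix transpose_matrix_vector)
  also have "\<dots> = (\<Sum>a\<in>UNIV. w $ a * ((x \<bullet> column a R) * (column a R \<bullet> y)))"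
    by (simp add: inner_vec_def matrix_vector_mult_def Diag_def transpose_def column_def
        if_distrib[where f="\<lambda>u. u * _"] sum.delta cong: if_cong) (simp add: algebra_simps)
  finally show ?thesis .
qed

lemma L_mat_entry: "L_mat R w $ i $ j = (\<Sum>a\<in>UNIV. w $ a * (R $ i $ a * R $ j $ a))"
  using L_mat_form[of "axis i 1" R w "axis j 1"]
  by (simp add: matrix_vector_mult_basis inner_axis inner_axis' column_def)

lemma kron_mult: "kron A B *v x = vec_of_mat (A ** mat_of_vec x ** transpose B)"
proof -
  have "linear (\<lambda>x. vec_of_mat (A ** mat_of_vec x ** transpose B))"
    by (auto intro!: linearI simp: vec_eq_iff vec_of_mat_def mat_of_vec_def matrix_matrix_mult_def
        sum.distrib sum_distrib_left sum_distrib_right algebra_simps)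
  then show ?thesis
    by (simp add: kron_def matrix_works)
qed

lemma kron_entry: "kron A B $ p $ q = A $ fst p $ fst q * B $ snd p $ snd q"
proof -
  have "kron A B $ p $ q = (kron A B *v axis q 1) $ p"
    by (simp add: matrix_vector_mult_basis column_def)
  also have "\<dots> = (\<Sum>k\<in>UNIV. (\<Sum>i\<in>UNIV. A $ fst p $ i * axis q 1 $ (i, k)) * B $ snd p $ k)"
    by (simp add: kron_mult vec_of_mat_def mat_of_vec_def matrix_matrix_mult_def transpose_def)
  also have "\<dots> = (\<Sum>k\<in>UNIV. \<Sum>i\<in>UNIV. if k = snd q then if i = fst q
      then A $ fst p $ i * B $ snd p $ k else 0 else 0)"
    by (cases q) (auto simp: axis_def sum_distrib_right intro!: sum.cong)
  also have "\<dots> = A $ fst p $ fst q * B $ snd p $ snd q"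
    by (subst sum.swap) (simp add: sum.delta)
  finally show ?thesis .
qed

lemma sum_swap_pairs:
  "(\<Sum>p\<in>P. \<Sum>q\<in>Q. \<Sum>a\<in>A. \<Sum>b\<in>B. f p q a b) = (\<Sum>a\<in>A. \<Sum>b\<in>B. \<Sum>p\<in>P. \<Sum>q\<in>Q. f p q a b)"
proof -
  have "(\<Sum>p\<in>P. \<Sum>q\<in>Q. \<Sum>a\<in>A. \<Sum>b\<in>B. f p q a b) = (\<Sum>p\<in>P. \<Sum>a\<in>A. \<Sum>b\<in>B. \<Sum>q\<in>Q. f p q a b)"
    by (intro sum.cong refl trans[OF sum.swap] sum.swap)
  also have "\<dots> = (\<Sum>a\<in>A. \<Sum>b\<in>B. \<Sum>p\<in>P. \<Sum>q\<in>Q. f p q a b)"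
    by (intro sum.cong refl trans[OF sum.swap] sum.swap)
  finally show ?thesis .
qed

text \<open>Both Kronecker factors are sums of the rank one matrices \<open>r\<^sub>a r\<^sub>a\<^sup>T\<close>, and
  \<open>r\<^sub>a r\<^sub>a\<^sup>T \<otimes> r\<^sub>b r\<^sub>b\<^sup>T\<close> is the rank one form \<open>(r\<^sub>a \<bullet> U r\<^sub>b) (r\<^sub>a \<bullet> U' r\<^sub>b)\<close>. The two weights
  are kept apart for the sake of the derivative in \<open>w\<close>.\<close>
lemma kron_L_mat_form:
  "u \<bullet> (kron (L_mat R w) (L_mat R w') *v v) = (\<Sum>a\<in>UNIV. \<Sum>b\<in>UNIV. w $ a * w' $ b *
     ((column a R \<bullet> (mat_of_vec u *v column b R)) * (column a R \<bullet> (mat_of_vec v *v column b R))))"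
proof -
  have form: "column a R \<bullet> (mat_of_vec x *v column b R)
     = (\<Sum>p\<in>UNIV. R $ fst p $ a * R $ snd p $ b * x $ p)" for a b x
    by (simp add: inner_vec_def matrix_vector_mult_def mat_of_vec_def column_def sum_distrib_left
       sum.cartesian_product UNIV_Times_UNIV case_prod_unfold algebra_simps)
  have entry: "kron (L_mat R w) (L_mat R w') $ p $ q = (\<Sum>a\<in>UNIV. \<Sum>b\<in>UNIV.
     (w $ a * (R $ fst p $ a * R $ fst q $ a)) * (w' $ b * (R $ snd p $ b * R $ snd q $ b)))"
    for p q
    by (simp add: kron_entry L_mat_entry sum_product)
  have "u \<bullet> (kron (L_mat R w) (L_mat R w') *v v) = (\<Sum>p\<in>UNIV. \<Sum>q\<in>UNIV. \<Sum>a\<in>UNIV. \<Sum>b\<in>UNIV.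
     u $ p * v $ q * (w $ a * (R $ fst p $ a * R $ fst q $ a))
       * (w' $ b * (R $ snd p $ b * R $ snd q $ b)))"
    by (simp add: inner_vec_def matrix_vector_mult_def entry
       sum_distrib_left sum_distrib_right mult.assoc mult.left_commute mult.commute)
  also have "\<dots> = (\<Sum>a\<in>UNIV. \<Sum>b\<in>UNIV. \<Sum>p\<in>UNIV. \<Sum>q\<in>UNIV.
     u $ p * v $ q * (w $ a * (R $ fst p $ a * R $ fst q $ a))
       * (w' $ b * (R $ snd p $ b * R $ snd q $ b)))"
    by (rule sum_swap_pairs)
  finally show ?thesis
    unfolding form sum_product
    by (simp add: sum_distrib_left mult.assoc mult.left_commute mult.commute)
qed

text \<open>The square of the sum over \<open>k\<close>, \<open>l\<close> of \<open>Q\<^sub>i\<^sub>k L\<^sub>k\<^sub>l Q\<^sub>j\<^sub>l\<close>, expanded as a double sum over pairs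
  of indices.\<close>
lemma khatri_rao_kron:
  "transpose (khatri_rao Q) ** kron L L ** khatri_rao Q
    = (Q ** L ** transpose Q) \<odot> (Q ** L ** transpose Q)"
proof -
  have "(\<Sum>k\<in>UNIV. (\<Sum>p\<in>UNIV. Q $ i $ snd p * Q $ i $ fst p * (L $ fst p $ fst k * L $ snd p $ snd k))
        * (Q $ j $ snd k * Q $ j $ fst k))
    = (\<Sum>k\<in>UNIV. (\<Sum>p\<in>UNIV. Q $ i $ p * L $ p $ k) * Q $ j $ k)
      * (\<Sum>k\<in>UNIV. (\<Sum>p\<in>UNIV. Q $ i $ p * L $ p $ k) * Q $ j $ k)" for i j
  proof -
    have "(\<Sum>p\<in>UNIV. Q $ i $ snd p * Q $ i $ fst p * (L $ fst p $ k * L $ snd p $ l))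
       = (\<Sum>p\<in>UNIV. Q $ i $ p * L $ p $ k) * (\<Sum>p\<in>UNIV. Q $ i $ p * L $ p $ l)" for k l
      by (simp add: sum_product sum.cartesian_product UNIV_Times_UNIV case_prod_unfold ac_simps)
    then show ?thesis
      unfolding sum_product[of "\<lambda>k. (\<Sum>p\<in>UNIV. Q $ i $ p * L $ p $ k) * Q $ j $ k"]
      by (simp add: sum.cartesian_product UNIV_Times_UNIV case_prod_unfold ac_simps)
  qed
  then show ?thesis
    by (simp add: vec_eq_iff matrix_matrix_mult_def hadamard_def transpose_def khatri_rao_def
        kron_entry)
qed

text \<open>The bilinear map whose value on the diagonal is \<open>L_hat\<close>; it carries the derivative.\<close>
definition polar_L_hat :: "real^'m^'l \<Rightarrow> real^('l \<times> 'l)^'k \<Rightarrow> real^'m \<Rightarrow> real^'m \<Rightarrow> real^'k^'k" where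
  "polar_L_hat R Rh v w = Rh ** kron (L_mat R v) (L_mat R w) ** transpose Rh"

text \<open>The entry \<open>r\<^sub>a \<bullet> U r\<^sub>b\<close> for \<open>U = mat(Rh\<^sup>T x)\<close>. When \<open>x\<close> is the \<open>i\<close>-th column of
  \<open>(Lh + I)\<^sup>-\<^sup>1 Dh\<^sup>T\<close>, the matrix \<open>U\<close> is \<open>L_tilde\<close> at \<open>i\<close>.\<close>
definition coupling :: "real^'m^'l \<Rightarrow> real^('l \<times> 'l)^'k \<Rightarrow> real^'k \<Rightarrow> 'm \<Rightarrow> 'm \<Rightarrow> real" where
  "coupling R Rh x a b = column a R \<bullet> (mat_of_vec (transpose Rh *v x) *v column b R)"

lemma polar_L_hat_form:
  "x \<bullet> (polar_L_hat R Rh v w *v y)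
    = (\<Sum>a\<in>UNIV. \<Sum>b\<in>UNIV. v $ a * w $ b * (coupling R Rh x a b * coupling R Rh y a b))"
proof -
  have "x \<bullet> (polar_L_hat R Rh v w *v y)
     = (transpose Rh *v x) \<bullet> (kron (L_mat R v) (L_mat R w) *v (transpose Rh *v y))"
    by (simp add: polar_L_hat_def inner_transpose_mult matrix_vector_mul_assoc matrix_mul_assoc
        del: transpose_matrix_vector)
  then show ?thesis
    by (simp only: kron_L_mat_form coupling_def)
qed

lemma L_hat_eq_polar: "L_hat R Rh w = polar_L_hat R Rh w w"
  by (simp add: L_hat_def polar_L_hat_def)

lemma polar_L_hat_entry:
  "polar_L_hat R Rh v w $ i $ j = (\<Sum>a\<in>UNIV. \<Sum>b\<in>UNIV. v $ a * w $ b *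
     (coupling R Rh (axis i 1) a b * coupling R Rh (axis j 1) a b))"
  using polar_L_hat_form[of "axis i 1" R Rh v w "axis j 1"]
  by (simp add: matrix_vector_mult_basis inner_axis inner_axis' column_def)

lemma transpose_L_hat: "transpose (L_hat R Rh w) = L_hat R Rh w"
  by (simp add: vec_eq_iff transpose_def L_hat_eq_polar polar_L_hat_entry mult.commute)

lemma L_hat_has_derivative:
  "(L_hat R Rh has_derivative (\<lambda>v. polar_L_hat R Rh w v + polar_L_hat R Rh v w)) (at w)"
proof -
  have "bilinear (polar_L_hat R Rh)"
    unfolding bilinear_def
    by (auto intro!: linearI simp: vec_eq_iff polar_L_hat_entry sum.distrib sum_distrib_left
      algebra_simps)
  then have "bounded_bilinear (polar_L_hat R Rh)"
    by (simp add: bilinear_conv_bounded_bilinear)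
  from bounded_bilinear.FDERIV[OF this has_derivative_ident has_derivative_ident]
  show ?thesis
    unfolding L_hat_eq_polar[abs_def] .
qed

text \<open>On the diagonal the form of \<open>L_hat\<close> is a sum of squares with weights \<open>w\<^sub>a w\<^sub>b\<close>, which are
  nonnegative.\<close>
lemma invertible_L_hat_plus_id:
  fixes Rh :: "real^('l::finite \<times> 'l)^'k"
  assumes "\<forall>a. 0 \<le> w $ a"
  shows "invertible (L_hat R Rh w + mat 1)"
proof (rule invertible_of_pos_def)
  fix x :: "real^'k" assume "x \<noteq> 0"
  have "0 \<le> x \<bullet> (L_hat R Rh w *v x)"
    unfolding L_hat_eq_polar polar_L_hat_form
    by (intro sum_nonneg mult_nonneg_nonneg[OF _ zero_le_square]) (use assms in auto)
  then show "0 < x \<bullet> ((L_hat R Rh w + mat 1) *v x)"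
    using \<open>x \<noteq> 0\<close> by (simp add: matrix_vector_mult_add_rdistrib inner_add_right add_nonneg_pos)
qed

section \<open>Gradient and monotonicity of the reduced objective\<close>

lemma sum_col_hadamard: "sum_col (R \<odot> (S ** R)) $ a = column a R \<bullet> (S *v column a R)"
  by (simp add: sum_col_def hadamard_def inner_vec_def column_def matrix_matrix_mult_def
      matrix_vector_mult_def)

definition A_opt_gradient ::
  "real^'m^'l \<Rightarrow> real^('l \<times> 'l)^'k \<Rightarrow> real^'k^'k \<Rightarrow> real^'m \<Rightarrow> real^'m" where
  "A_opt_gradient R Rh Dh w = - sum_col (R \<odot> ((\<Sum>i\<in>UNIV.
      L_tilde R Rh Dh w i ** L_mat R w ** transpose (L_tilde R Rh Dh w i)
      + transpose (L_tilde R Rh Dh w i) ** L_mat R w ** L_tilde R Rh Dh w i) ** R))"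

text \<open>The \<open>a\<close>-th column sum of \<open>R \<odot> (S R)\<close> is the quadratic form of \<open>S\<close> at \<open>r\<^sub>a\<close>, and both summands
  of \<open>S\<close> are congruent to \<open>L\<close>. In this form the sign of the gradient is visible.\<close>
lemma A_opt_gradient_entry:
  "A_opt_gradient R Rh Dh w $ a = - (\<Sum>i\<in>UNIV. \<Sum>b\<in>UNIV. w $ b *
     ((column a R \<bullet> (L_tilde R Rh Dh w i *v column b R))\<^sup>2
      + (column b R \<bullet> (L_tilde R Rh Dh w i *v column a R))\<^sup>2))"
proof -
  let ?r = "column a R" and ?L = "L_mat R w" and ?T = "L_tilde R Rh Dh w"
  have "?r \<bullet> ((?T i ** ?L ** transpose (?T i) + transpose (?T i) ** ?L ** ?T i) *v ?r)
      = (\<Sum>b\<in>UNIV. w $ b * ((?r \<bullet> (?T i *v column b R))\<^sup>2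
      + (column b R \<bullet> (?T i *v ?r))\<^sup>2))" for i
  proof -
    have "?r \<bullet> ((?T i ** ?L ** transpose (?T i) + transpose (?T i) ** ?L ** ?T i) *v ?r)
       = (transpose (?T i) *v ?r) \<bullet> (?L *v (transpose (?T i) *v ?r))
         + (?T i *v ?r) \<bullet> (?L *v (?T i *v ?r))"
      using inner_transpose_mult[of "transpose (?T i)" ?r "?L *v (?T i *v ?r)"]
      by (simp add: matrix_vector_mult_add_rdistrib inner_add_right inner_transpose_mult
          matrix_vector_mul_assoc matrix_mul_assoc del: transpose_matrix_vector)
    also have "\<dots> = (\<Sum>b\<in>UNIV. w $ b * ((?r \<bullet> (?T i *v column b R))\<^sup>2
      + (column b R \<bullet> (?T i *v ?r))\<^sup>2))"
      unfolding L_mat_form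
      by (simp add: inner_transpose_mult inner_commute[of "column _ R"] power2_eq_square
          sum.distrib[symmetric] algebra_simps del: transpose_matrix_vector)
    finally show ?thesis .
  qed
  then show ?thesis
    by (simp add: A_opt_gradient_def sum_col_hadamard matrix_sum_vector_mult inner_sum_right)
qed

text \<open>With \<open>Y = (Lh + I)\<^sup>-\<^sup>1 Dh\<^sup>T\<close> and the symmetry of \<open>Lh\<close>, the derivative in direction \<open>v\<close> is minus
  \<open>tr(Y\<^sup>T (polar w v + polar v w) Y)\<close>, a sum over the columns of \<open>Y\<close>. Exchanging the names of
  \<open>a\<close> and \<open>b\<close> in the part from \<open>polar w v\<close> isolates the factor \<open>v\<^sub>a\<close>.\<close>
lemma reduced_objective_has_derivative:
  fixes Rh :: "real^('l::finite \<times> 'l)^'k" and Dh :: "real^'k^'k"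
  assumes inv: "invertible (L_hat R Rh w + mat 1)"
  shows "((\<lambda>w. trace (matrix_inv (L_hat R Rh w + mat 1) ** (transpose Dh ** Dh)))
    has_derivative (\<lambda>v. v \<bullet> A_opt_gradient R Rh Dh w)) (at w)"
proof -
  let ?A = "\<lambda>w. L_hat R Rh w + mat 1"
  let ?A' = "\<lambda>w v. polar_L_hat R Rh w v + polar_L_hat R Rh v w"
  let ?B = "matrix_inv (?A w)"
  have der: "(?A has_derivative ?A' w) (at w)" for w
    using has_derivative_add[OF L_hat_has_derivative has_derivative_const] by simp
  have "((\<lambda>w. trace (matrix_inv (?A w) ** (transpose Dh ** Dh))) has_derivative
      (\<lambda>v. - trace (?B ** ?A' w v ** ?B ** (transpose Dh ** Dh)))) (at w)"
    by (rule has_derivative_trace_matrix_inv[OF _ der inv]) (use der differentiable_def in blast)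
  moreover have "- trace (?B ** ?A' w v ** ?B ** (transpose Dh ** Dh))
      = v \<bullet> A_opt_gradient R Rh Dh w" for v
  proof -
    define Y where "Y = ?B ** transpose Dh"
    have symB: "transpose ?B = ?B"
      by (rule transpose_matrix_inv[OF inv]) (simp add: transpose_add transpose_L_hat transpose_mat)
    have tilde: "coupling R Rh (column i Y) a b = column a R \<bullet> (L_tilde R Rh Dh w i *v column b R)"
      for i a b
      by (simp add: coupling_def L_tilde_def Y_def column_mult matrix_vector_mul_assoc
          matrix_mul_assoc del: transpose_matrix_vector)
    have "trace (?B ** ?A' w v ** ?B ** (transpose Dh ** Dh))
       = trace ((?B ** ?A' w v ** ?B ** transpose Dh) ** Dh)"
      by (simp add: matrix_mul_assoc)
    also have "\<dots> = trace (transpose Y ** ?A' w v ** Y)"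
      by (subst trace_mult_commute)
         (simp add: Y_def matrix_transpose_mul symB matrix_mul_assoc)
    also have "\<dots> = (\<Sum>i\<in>UNIV. \<Sum>a\<in>UNIV. \<Sum>b\<in>UNIV.
        (w $ a * v $ b + v $ a * w $ b) * (coupling R Rh (column i Y) a b)\<^sup>2)"
      by (simp add: trace_congruence matrix_vector_mult_add_rdistrib inner_add_right
          polar_L_hat_form sum.distrib[symmetric] power2_eq_square algebra_simps)
    also have "\<dots> = (\<Sum>i\<in>UNIV. \<Sum>a\<in>UNIV. \<Sum>b\<in>UNIV. v $ a * (w $ b *
        ((coupling R Rh (column i Y) a b)\<^sup>2 + (coupling R Rh (column i Y) b a)\<^sup>2)))"
      (is "(\<Sum>i\<in>UNIV. ?l i) = (\<Sum>i\<in>UNIV. ?r i)")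
    proof (rule sum.cong)
      fix i
      have "?l i = (\<Sum>a\<in>UNIV. \<Sum>b\<in>UNIV. w $ a * v $ b * (coupling R Rh (column i Y) a b)\<^sup>2)
         + (\<Sum>a\<in>UNIV. \<Sum>b\<in>UNIV. v $ a * w $ b * (coupling R Rh (column i Y) a b)\<^sup>2)"
        by (simp add: sum.distrib[symmetric] algebra_simps)
      also have "(\<Sum>a\<in>UNIV. \<Sum>b\<in>UNIV. w $ a * v $ b * (coupling R Rh (column i Y) a b)\<^sup>2)
         = (\<Sum>a\<in>UNIV. \<Sum>b\<in>UNIV. w $ b * v $ a * (coupling R Rh (column i Y) b a)\<^sup>2)"
        by (rule sum.swap)
      finally show "?l i = ?r i"
        by (simp add: sum.distrib[symmetric] algebra_simps)
    qed simp
    also have "\<dots> = (\<Sum>a\<in>UNIV. v $ a * (\<Sum>i\<in>UNIV. \<Sum>b\<in>UNIV. w $ b *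
        ((coupling R Rh (column i Y) a b)\<^sup>2 + (coupling R Rh (column i Y) b a)\<^sup>2)))"
      by (subst sum.swap) (simp add: sum_distrib_left)
    finally show ?thesis
      by (simp add: inner_vec_def A_opt_gradient_entry sum_negf tilde)
  qed
  ultimately show ?thesis
    by simp
qed

text \<open>The segment from \<open>w\<close> to \<open>w'\<close> stays in the nonnegative orthant, where no entry of the gradient is
  positive.\<close>
lemma reduced_objective_antimono:
  fixes Rh :: "real^('l::finite \<times> 'l)^'k" and Dh :: "real^'k^'k"
  assumes w: "\<forall>a. 0 \<le> w $ a" and le: "\<forall>a. w $ a \<le> w' $ a"
  shows "trace (matrix_inv (L_hat R Rh w' + mat 1) ** (transpose Dh ** Dh))
    \<le> trace (matrix_inv (L_hat R Rh w + mat 1) ** (transpose Dh ** Dh))"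
proof -
  let ?J = "\<lambda>w. trace (matrix_inv (L_hat R Rh w + mat 1) ** (transpose Dh ** Dh))"
  let ?p = "\<lambda>t. w + t *\<^sub>R (w' - w)"
  have "?J (?p 1) \<le> ?J (?p 0)"
  proof (rule DERIV_nonpos_imp_nonincreasing[where f = "\<lambda>t. ?J (?p t)"])
    fix t :: real assume t: "0 \<le> t" "t \<le> 1"
    have nn: "\<forall>a. 0 \<le> ?p t $ a"
      using w le t by simp
    have "((\<lambda>t. ?J (?p t)) has_derivative
        (\<lambda>s. (s *\<^sub>R (w' - w)) \<bullet> A_opt_gradient R Rh Dh (?p t))) (at t)"
      by (rule has_derivative_compose[where f = ?p,
            OF _ reduced_objective_has_derivative[OF invertible_L_hat_plus_id[OF nn]]])
         (auto intro!: derivative_eq_intros)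
    then have "((\<lambda>t. ?J (?p t)) has_real_derivative
        (w' - w) \<bullet> A_opt_gradient R Rh Dh (?p t)) (at t)"
      by (simp add: has_field_derivative_def mult_commute_abs)
    moreover have "(w' - w) \<bullet> A_opt_gradient R Rh Dh (?p t) \<le> 0"
      unfolding inner_vec_def A_opt_gradient_entry
      by (intro sum_nonpos)
         (use le nn in \<open>auto intro!: mult_nonneg_nonneg sum_nonneg simp del: vector_add_component\<close>)
    ultimately show "\<exists>y. ((\<lambda>t. ?J (?p t)) has_real_derivative y) (at t) \<and> y \<le> 0"
      by blast
  qed simp
  then show ?thesis
    by simp
qed

section \<open>Reduction of the posterior covariance to the small matrices\<close>

text \<open>The matrix \<open>I + Q L Q\<^sup>T\<close> is the identity on the orthogonal complement of the range of \<open>Q\<close>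
  and maps \<open>Q y\<close> to \<open>Q (L + I) y\<close>.\<close>
lemma inverse_id_plus_projected:
  fixes Q :: "real^'k^'n" and L :: "real^'k^'k"
  assumes Q: "transpose Q ** Q = mat 1" and L: "invertible (L + mat 1)"
  shows "(mat 1 + Q ** L ** transpose Q) **
    (mat 1 - Q ** transpose Q + Q ** matrix_inv (L + mat 1) ** transpose Q) = mat 1"
proof -
  let ?B = "matrix_inv (L + mat 1)" and ?Z = "mat 1 + Q ** L ** transpose Q"
  have ZQ: "?Z ** Q = Q ** (L + mat 1)"
    by (simp add: matrix_add_distrib matrix_add_ldistrib)
       (simp add: matrix_mul_assoc[symmetric] Q)
  have "?Z ** (mat 1 - Q ** transpose Q + Q ** ?B ** transpose Q)
      = ?Z - ?Z ** Q ** transpose Q + ?Z ** Q ** ?B ** transpose Q"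
    by (simp add: matrix_add_ldistrib matrix_diff_distrib2 matrix_mul_assoc)
  also have "\<dots> = ?Z - Q ** (L + mat 1) ** transpose Q
      + Q ** ((L + mat 1) ** ?B) ** transpose Q"
    unfolding ZQ by (simp add: matrix_mul_assoc)
  also have "\<dots> = mat 1"
    unfolding matrix_inv_mult[OF L] by (simp add: matrix_add_distrib matrix_add_ldistrib)
  finally show ?thesis .
qed

text \<open>The reduction in matrix form; \<open>W\<close> stands for \<open>M\<^sup>-\<^sup>1\<^sup>/\<^sup>2\<close>, \<open>V\<close> for its inverse and \<open>N\<close> for
  \<open>L \<otimes> L\<close>. The key relation is \<open>T W X = W X\<^sup>-\<^sup>1 Z\<close> with \<open>X = W C W\<close> and
  \<open>Z = I + Qh Lh Qh\<^sup>T\<close>, which exhibits the inverse \<open>W X Z\<^sup>-\<^sup>1 X V\<close> of \<open>T\<close>.\<close>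
lemma precision_inverse:
  fixes W V C :: "real^'n^'n" and K :: "real^'n^'p" and Qh :: "real^'k^'n" and Rh :: "real^'p^'k"
  assumes VW: "V ** W = mat 1" and W: "transpose W = W" and C: "transpose C = C"
    and inv: "invertible (W ** W ** C ** (W ** W) ** C)"
    and QR: "Qh ** Rh = W ** C ** (W ** W) ** transpose K"
    and orth: "transpose Qh ** Qh = mat 1"
    and Lh: "Lh = Rh ** N ** transpose Rh" "invertible (Lh + mat 1)"
  defines "T \<equiv> W ** W ** (transpose K ** N ** K) + matrix_inv (W ** W ** C ** (W ** W) ** C)"
  shows "invertible T"
    and "trace (matrix_inv T) = trace (W ** W ** C ** (W ** W) ** C)
      - trace (transpose Qh ** W ** C ** (W ** W) ** C ** W ** Qh)
      + trace (matrix_inv (Lh + mat 1) ** (transpose Qh ** W ** C ** (W ** W) ** C ** W ** Qh))"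
proof -
  define X where "X = W ** C ** W"
  define U where "U = matrix_inv X"
  define B where "B = matrix_inv (Lh + mat 1)"
  define Z where "Z = mat 1 + Qh ** Lh ** transpose Qh"
  define Y where "Y = mat 1 - Qh ** transpose Qh + Qh ** B ** transpose Qh"
  have WV: "W ** V = mat 1"
    using VW matrix_left_right_inverse by blast
  have cancel: "A ** V ** W = A" "A ** W ** V = A" for A :: "real^'n^'m"
    by (simp_all add: matrix_mul_assoc[symmetric] VW WV)
  have "det W \<noteq> 0"
    using VW by (metis det_I det_mul mult_zero_right zero_neq_one)
  moreover have "det C \<noteq> 0"
    using inv by (auto simp: invertible_det_nz det_mul)
  ultimately have X_inv: "invertible X"
    by (simp add: X_def invertible_det_nz det_mul)
  have XU: "A ** X ** U = A" "A ** U ** X = A" for A :: "real^'n^'m"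
    by (simp_all add: U_def matrix_mul_assoc[symmetric] matrix_inv_mult X_inv)
  have X: "transpose X = X"
    by (simp add: X_def matrix_transpose_mul W C matrix_mul_assoc)
  have C0: "W ** W ** C ** (W ** W) ** C = W ** X ** X ** V"
    by (simp add: X_def matrix_mul_assoc cancel)
  have XX: "W ** C ** (W ** W) ** C ** W = X ** X"
    by (simp add: X_def matrix_mul_assoc)
  have "(W ** X ** X ** V) ** (W ** U ** U ** V) = mat 1"
    by (simp add: matrix_mul_assoc cancel XU WV)
  then have C0_inv: "matrix_inv (W ** W ** C ** (W ** W) ** C) = W ** U ** U ** V"
    unfolding C0 by (rule matrix_inv_eqI)
  have QR': "Qh ** Rh = X ** W ** transpose K"
    by (simp add: QR X_def matrix_mul_assoc)
  have QR'': "K ** W ** X = transpose Rh ** transpose Qh"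
  proof -
    have "transpose (Qh ** Rh) = K ** W ** X"
      by (simp add: QR' matrix_transpose_mul W X matrix_mul_assoc)
    then show ?thesis
      by (simp add: matrix_transpose_mul)
  qed
  \<comment> \<open>Inserting \<open>U X = I\<close> completes the left factor to \<open>Qh Rh\<close>; the right one is its transpose.\<close>
  have "W ** W ** (transpose K ** N ** K) ** (W ** X)
      = W ** U ** (X ** W ** transpose K) ** N ** (K ** W ** X)"
    by (simp add: matrix_mul_assoc XU)
  also have "\<dots> = W ** U ** (Qh ** Lh ** transpose Qh)"
    by (simp add: QR'[symmetric] QR'' Lh matrix_mul_assoc)
  finally have "T ** (W ** X) = W ** U ** Z"
    unfolding T_def C0_inv Z_def matrix_add_distrib matrix_add_ldistrib
    by (simp add: matrix_mul_assoc cancel XU)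
  then have "T ** (W ** X ** Y ** X ** V) = W ** U ** (Z ** Y) ** X ** V"
    by (simp add: matrix_mul_assoc)
  also have "Z ** Y = mat 1"
    unfolding Z_def Y_def B_def by (rule inverse_id_plus_projected[OF orth Lh(2)])
  finally have TT: "T ** (W ** X ** Y ** X ** V) = mat 1"
    by (simp add: XU WV)
  from TT show "invertible T"
    by (rule matrix_inv_eqI)
  have rotate: "trace (W ** A ** V) = trace A" for A
    using trace_mult_commute[of "W ** A" V] by (simp add: matrix_mul_assoc VW)
  have "trace (matrix_inv T) = trace (W ** (X ** Y ** X) ** V)"
    using matrix_inv_eqI(2)[OF TT] by (simp add: matrix_mul_assoc)
  also have "\<dots> = trace (X ** (Y ** X))"
    unfolding rotate by (simp add: matrix_mul_assoc)
  also have "\<dots> = trace (Y ** (X ** X))"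
    using trace_mult_commute[of X "Y ** X"] by (simp add: matrix_mul_assoc)
  also have "\<dots> = trace (X ** X) - trace (Qh ** (transpose Qh ** (X ** X)))
      + trace (Qh ** (B ** transpose Qh ** (X ** X)))"
    by (simp add: Y_def matrix_add_distrib matrix_diff_distrib trace_add trace_sub matrix_mul_assoc)
  also have "trace (Qh ** (transpose Qh ** (X ** X))) = trace (transpose Qh ** (X ** X) ** Qh)"
    by (rule trace_mult_commute)
  also have "trace (Qh ** (B ** transpose Qh ** (X ** X)))
      = trace (B ** (transpose Qh ** (X ** X) ** Qh))"
    by (subst trace_mult_commute) (simp add: matrix_mul_assoc)
  also have "trace (X ** X) = trace (W ** W ** C ** (W ** W) ** C)"
    unfolding C0 using rotate[of "X ** X"] by (simp add: matrix_mul_assoc)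
  finally show "trace (matrix_inv T) = trace (W ** W ** C ** (W ** W) ** C)
      - trace (transpose Qh ** W ** C ** (W ** W) ** C ** W ** Qh)
      + trace (matrix_inv (Lh + mat 1) ** (transpose Qh ** W ** C ** (W ** W) ** C ** W ** Qh))"
    unfolding XX[symmetric] B_def by (simp add: matrix_mul_assoc)
qed

text \<open>The square root \<open>S\<close> acts by \<open>M\<^sup>-\<^sup>1 C\<close>, so the prior covariance acts by \<open>M\<^sup>-\<^sup>1 C M\<^sup>-\<^sup>1 C\<close>, whose
  positivity makes it invertible; the first QR factorization turns the symmetrised misfit
  \<open>W F\<^sup>T \<Gamma>\<^sup>\<dagger> F W\<close> into \<open>Q L Q\<^sup>T\<close>.\<close>
lemma trace_C_post:
  fixes \<Omega> :: "(real^'d) set"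
    and E :: "'n::finite \<Rightarrow> (real^'d) set"
    and F :: "(real^'d \<Rightarrow> real) \<Rightarrow> real^'m"
    and \<Gamma> :: "real^'m^'m"
    and Q :: "real^'l::finite^'n"
    and R :: "real^'m^'l"
    and Qh :: "real^'k^'n"
    and Rh :: "real^('l \<times> 'l)^'k"
  assumes mesh: "is_mesh \<Omega> E"
    and M: "M = mass_mat E"
    and F: "lin_obs (Vh E) F"
    and C0: "pos_def_op \<Omega> (Vh E) C0"
    and S: "is_op_sqrt \<Omega> (Vh E) C0 S"
    and C: "C = op_mat \<Omega> E S"
    and QR: "Q ** R = inv_sqrt_diag M ** transpose (obs_mat E F) ** inv_sqrt_diag \<Gamma>"
    and QRh: "Qh ** Rh = inv_sqrt_diag M ** C ** matrix_inv M ** transpose (khatri_rao Q)"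
    and orth: "transpose Qh ** Qh = mat 1"
    and inv: "invertible (L_hat R Rh w + mat 1)"
  shows "bij_betw (precision_op \<Omega> E F \<Gamma> C0 w) (Vh E) (Vh E)"
    and "A_opt \<Omega> E F \<Gamma> C0 w =
      trace (matrix_inv M ** C ** matrix_inv M ** C) - trace (C_hat M C Qh)
      + trace (matrix_inv (L_hat R Rh w + mat 1) ** C_hat M C Qh)"
proof -
  define W where "W = inv_sqrt_diag M"
  define V where "V = Diag (\<chi> i. sqrt (measure lebesgue (E i)))"
  define G where "G = inv_sqrt_diag \<Gamma>"
  define P where "P = W ** transpose (obs_mat E F) ** Gamma_dag \<Gamma> w ** obs_mat E F ** W"
  have W: "W ** W = matrix_inv M" "V ** W = mat 1" "transpose W = W"
    using inv_sqrt_mass[OF mesh] by (simp_all add: W_def V_def M)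
  have G: "transpose G = G"
    by (simp add: G_def inv_sqrt_diag_def transpose_Diag)
  obtain T where T: "acts_as E S T"
    using S lin_op_acts_as[OF mesh, of S] by (auto simp: is_op_sqrt_def)
  have T_eq: "T = matrix_inv M ** C"
    using acts_as_op_mat[OF mesh T] by (simp add: C M)
  have symC: "transpose C = C"
    using S self_adjoint_op_mat[OF mesh] by (simp add: is_op_sqrt_def C)
  have C0_acts: "acts_as E C0 (matrix_inv M ** C ** matrix_inv M ** C)"
  proof -
    have "acts_as E (S \<circ> S) (T ** T)"
      by (rule acts_as_comp[OF T T])
    then show ?thesis
      using S by (simp add: is_op_sqrt_def acts_as_def T_eq matrix_mul_assoc)
  qed
  have C0_inv: "invertible (matrix_inv M ** C ** matrix_inv M ** C)"
    by (rule pos_def_op_invertible[OF mesh C0_acts C0])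
  have P_eq: "P = Q ** L_mat R w ** transpose Q"
  proof -
    have "P = (W ** transpose (obs_mat E F) ** G) ** Diag w
        ** transpose (W ** transpose (obs_mat E F) ** G)"
      by (simp add: P_def Gamma_dag_def G_def[symmetric] matrix_transpose_mul W G matrix_mul_assoc)
    also have "\<dots> = Q ** L_mat R w ** transpose Q"
      unfolding W_def G_def QR[symmetric]
      by (simp add: L_mat_def matrix_transpose_mul matrix_mul_assoc)
    finally show ?thesis .
  qed
  let ?K = "khatri_rao Q" and ?N = "kron (L_mat R w) (L_mat R w)"
  let ?T = "W ** W ** (transpose ?K ** ?N ** ?K) + matrix_inv (W ** W ** C ** (W ** W) ** C)"
  have "acts_as E (Hess_op \<Omega> E F \<Gamma> w) (W ** W ** (transpose ?K ** ?N ** ?K))"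
    using Hess_op_acts_as[OF mesh F, of \<Gamma> w]
    unfolding khatri_rao_kron P_eq[symmetric] W(1) unfolding P_def W_def M .
  moreover have "acts_as E (inv_into (Vh E) C0) (matrix_inv (W ** W ** C ** (W ** W) ** C))"
    using inv_into_acts_as(2)[OF mesh C0_acts C0_inv] by (simp add: W)
  ultimately have prec: "acts_as E (precision_op \<Omega> E F \<Gamma> C0 w) ?T"
    by (simp add: acts_as_def precision_op_def matrix_vector_mult_add_rdistrib fe_fun_add)
  have pre: "invertible (W ** W ** C ** (W ** W) ** C)"
    "Qh ** Rh = W ** C ** (W ** W) ** transpose ?K"
    using C0_inv QRh by (simp_all add: W(1)) (simp add: W_def)
  note reduced = precision_inverse[OF W(2,3) symC pre orth L_hat_def inv]
  note inverse = inv_into_acts_as[OF mesh prec reduced(1)]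
  from inverse(1) show "bij_betw (precision_op \<Omega> E F \<Gamma> C0 w) (Vh E) (Vh E)" .
  have "A_opt \<Omega> E F \<Gamma> C0 w = trace (matrix_inv ?T)"
    unfolding A_opt_def C_post_def by (rule op_trace_eq[OF mesh inverse(2)])
  also note reduced(2)
  finally show "A_opt \<Omega> E F \<Gamma> C0 w =
      trace (matrix_inv M ** C ** matrix_inv M ** C) - trace (C_hat M C Qh)
      + trace (matrix_inv (L_hat R Rh w + mat 1) ** C_hat M C Qh)"
    by (simp add: W(1) C_hat_def W_def[symmetric])
qed

section \<open>The A-optimal objective and its gradient\<close>

theorem theorem3p6:
  fixes \<Omega> :: "(real^'d) set"
    and E :: "'n::finite \<Rightarrow> (real^'d) set"
    and F :: "(real^'d \<Rightarrow> real) \<Rightarrow> real^'m::{finite,linorder}"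
    and \<Gamma> :: "real^'m::{finite,linorder}^'m::{finite,linorder}"
    and C0 S :: "(real^'d \<Rightarrow> real) \<Rightarrow> (real^'d \<Rightarrow> real)"
    and M C :: "real^'n^'n"
    and Q :: "real^'l::{finite,linorder}^'n"
    and R :: "real^'m::{finite,linorder}^'l::{finite,linorder}"
    and Qh :: "real^'k::{finite,linorder}^'n"
    and Rh :: "real^('l \<times> 'l)^'k::{finite,linorder}"
    and Dh :: "real^'k::{finite,linorder}^'k::{finite,linorder}"
  assumes mesh: "is_mesh \<Omega> E"
    and M: "M = mass_mat E"
    and F: "lin_obs (Vh E) F"
    and \<Gamma>_diagonal: "\<forall>i j. i \<noteq> j \<longrightarrow> \<Gamma> $ i $ j = 0"
    and \<Gamma>_pos_def: "\<forall>x. x \<noteq> 0 \<longrightarrow> 0 < x \<bullet> (\<Gamma> *v x)"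
    and C0: "lin_op (Vh E) C0" "self_adjoint_op \<Omega> (Vh E) C0" "pos_def_op \<Omega> (Vh E) C0"
    and S: "is_op_sqrt \<Omega> (Vh E) C0 S"
    and C: "C = op_mat \<Omega> E S"
    and QR: "is_thin_qr pos
               (inv_sqrt_diag M ** transpose (obs_mat E F) ** inv_sqrt_diag \<Gamma>) Q R"
    and QRh: "is_thin_qr pos_pair
               (inv_sqrt_diag M ** C ** matrix_inv M ** transpose (khatri_rao Q)) Qh Rh"
    and Dh: "is_cholesky (C_hat M C Qh) Dh"
  shows "(\<exists>U. open U \<and> {w. \<forall>i. 0 \<le> w $ i \<and> w $ i \<le> 1} \<subseteq> U \<and>
            (\<forall>w\<in>U.
               bij_betw (precision_op \<Omega> E F \<Gamma> C0 w) (Vh E) (Vh E) \<and>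
               invertible (L_hat R Rh w + mat 1) \<and>
               A_opt \<Omega> E F \<Gamma> C0 w =
                 trace (matrix_inv M ** C ** matrix_inv M ** C) - trace (C_hat M C Qh)
                 + trace (matrix_inv (L_hat R Rh w + mat 1) ** C_hat M C Qh) \<and>
               GDERIV (A_opt \<Omega> E F \<Gamma> C0) w :>
                 - sum_col (R \<odot> ((\<Sum>i\<in>UNIV.
                     L_tilde R Rh Dh w i ** L_mat R w ** transpose (L_tilde R Rh Dh w i)
                     + transpose (L_tilde R Rh Dh w i) ** L_mat R w ** L_tilde R Rh Dh w i) ** R))))
       \<and> (\<forall>w w'. (\<forall>i. 0 \<le> w $ i \<and> w $ i \<le> 1) \<and> (\<forall>i. 0 \<le> w' $ i \<and> w' $ i \<le> 1) \<and>
             (\<forall>i. w $ i \<le> w' $ i) \<longrightarrow>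
             A_opt \<Omega> E F \<Gamma> C0 w' \<le> A_opt \<Omega> E F \<Gamma> C0 w)"
proof -
  let ?J = "A_opt \<Omega> E F \<Gamma> C0"
  let ?const = "trace (matrix_inv M ** C ** matrix_inv M ** C) - trace (C_hat M C Qh)"
  let ?red = "\<lambda>w. trace (matrix_inv (L_hat R Rh w + mat 1) ** (transpose Dh ** Dh))"
  let ?U = "{w. invertible (L_hat R Rh w + mat 1)}"
  have chol: "C_hat M C Qh = transpose Dh ** Dh"
    using Dh by (simp add: is_cholesky_def)
  have fac: "Q ** R = inv_sqrt_diag M ** transpose (obs_mat E F) ** inv_sqrt_diag \<Gamma>"
    "Qh ** Rh = inv_sqrt_diag M ** C ** matrix_inv M ** transpose (khatri_rao Q)"
    "transpose Qh ** Qh = mat 1"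
    using QR QRh by (simp_all add: is_thin_qr_def)
  note post = trace_C_post[OF mesh M F C0(3) S C fac]
  have J: "?J w = ?const + ?red w" if "w \<in> ?U" for w
    using post(2)[of w] that by (simp add: chol)
  have open_U: "open ?U"
  proof (rule open_invertible)
    show "(\<lambda>w. L_hat R Rh w + mat 1) differentiable (at w)" for w
      by (intro differentiable_add differentiable_const)
         (use L_hat_has_derivative differentiable_def in blast)
  qed
  have box: "w \<in> ?U" if "\<forall>i. 0 \<le> w $ i" for w
    using invertible_L_hat_plus_id that by simp
  have grad: "GDERIV ?J w :> A_opt_gradient R Rh Dh w" if "w \<in> ?U" for w
  proof -
    have "((\<lambda>w. ?const + ?red w) has_derivative (\<lambda>v. v \<bullet> A_opt_gradient R Rh Dh w)) (at w)"
      using has_derivative_add[OF has_derivative_const reduced_objective_has_derivative, of R Rh w]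
        that by simp
    then show ?thesis
      unfolding gderiv_def
      by (rule has_derivative_transform_within_open[OF _ open_U that]) (rule J[symmetric])
  qed
  have mono: "?J w' \<le> ?J w"
    if "\<forall>i. 0 \<le> w $ i" "\<forall>i. w $ i \<le> w' $ i" for w w'
  proof -
    have w': "\<forall>i. 0 \<le> w' $ i"
      using that order_trans by blast
    show ?thesis
      using reduced_objective_antimono[OF that, of R Rh Dh] J[OF box[OF that(1)]]
        J[OF box[OF w']] by linarith
  qed
  show ?thesis
    unfolding A_opt_gradient_def[symmetric]
  proof (intro conjI exI[of _ ?U] ballI allI impI)
    show "open ?U"
      by (rule open_U)
    show "{w. \<forall>i. 0 \<le> w $ i \<and> w $ i \<le> 1} \<subseteq> ?U"
      using box by blast
  next
    fix w assume w: "w \<in> ?U"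
    then show inv: "invertible (L_hat R Rh w + mat 1)"
      by simp
    show "bij_betw (precision_op \<Omega> E F \<Gamma> C0 w) (Vh E) (Vh E)"
      by (rule post(1)[OF inv])
    show "?J w = ?const + trace (matrix_inv (L_hat R Rh w + mat 1) ** C_hat M C Qh)"
      by (rule post(2)[OF inv])
    show "GDERIV ?J w :> A_opt_gradient R Rh Dh w"
      by (rule grad[OF w])
  next
    fix w w' :: "real^'m::{finite,linorder}"
    assume "(\<forall>i. 0 \<le> w $ i \<and> w $ i \<le> 1) \<and> (\<forall>i. 0 \<le> w' $ i \<and> w' $ i \<le> 1) \<and>
      (\<forall>i. w $ i \<le> w' $ i)"
    then show "?J w' \<le> ?J w"
      by (intro mono) blast+
  qed
qed

end
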